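(* Let $R$ be an associative ring with identity, $M$ a right $R$-module which is a self-generator, and $S=\mathrm{End}_R(M)$. The following conditions are equivalent: (1) $S$ is a semiregular ring with $J(S)=\Delta(S)$. (2) $M$ is a CS-Rickart module and a $C2$ module.
   Context: $M$ is a self-generator if it generates all its submodules, i.e. every submodule $N\le M$ is the sum of the images of all homomorphisms $M\to N$. $\Delta(S)=\{f\in S \mid \mathrm{Ker}(f) \text{ is an essential submodule of } M\}$. $J(S)$ is the Jacobson radical of $S$. A ring $S$ is semiregular if $S/J(S)$ is von Neumann regular and idempotents lift modulo $J(S)$. $M$ is CS-Rickart if for every endomorphism $\varphi$ of $M$, $\mathrm{Ker}(\varphi)$ is an essential submodule of a direct summand of $M$. $M$ is a $C2$ module if every submodule of $M$ that is isomorphic to a direct summand of $M$ is itself a direct summand of $M$. *)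

theory Defs
  imports "HOL-Algebra.Algebra"
begin

text \<open>
  The library locale \<open>module\<close> is restricted to commutative rings. Right modules over an
  arbitrary ring are carried here by the same record: \<open>a \<odot>\<^bsub>M\<^esub> x\<close> denotes the right action
  of the scalar \<open>a\<close> on \<open>x\<close>, usually written \<open>x a\<close>. The law \<open>x (a b) = (x a) b\<close> therefore
  reverses the order of the factors in \<open>smult_assoc\<close>. The library predicate \<open>submodule\<close> does not
  depend on the associativity law and is used unchanged.
\<close>

locale right_module = R?: ring R + M?: abelian_group M
  for R :: "('a, 'r) ring_scheme" (structure) and M :: "('a, 'b, 'm) module_scheme" (structure) +
  assumes smult_closed [simp, intro]:
      "\<lbrakk>a \<in> carrier R; x \<in> carrier M\<rbrakk> \<Longrightarrow> a \<odot>\<^bsub>M\<^esub> x \<in> carrier M"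
    and smult_l_distr:
      "\<lbrakk>a \<in> carrier R; b \<in> carrier R; x \<in> carrier M\<rbrakk> \<Longrightarrow>
        (a \<oplus> b) \<odot>\<^bsub>M\<^esub> x = a \<odot>\<^bsub>M\<^esub> x \<oplus>\<^bsub>M\<^esub> b \<odot>\<^bsub>M\<^esub> x"
    and smult_r_distr:
      "\<lbrakk>a \<in> carrier R; x \<in> carrier M; y \<in> carrier M\<rbrakk> \<Longrightarrow>
        a \<odot>\<^bsub>M\<^esub> (x \<oplus>\<^bsub>M\<^esub> y) = a \<odot>\<^bsub>M\<^esub> x \<oplus>\<^bsub>M\<^esub> a \<odot>\<^bsub>M\<^esub> y"
    and smult_assoc:
      "\<lbrakk>a \<in> carrier R; b \<in> carrier R; x \<in> carrier M\<rbrakk> \<Longrightarrow>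
        (a \<otimes> b) \<odot>\<^bsub>M\<^esub> x = b \<odot>\<^bsub>M\<^esub> (a \<odot>\<^bsub>M\<^esub> x)"
    and smult_one [simp]:
      "x \<in> carrier M \<Longrightarrow> \<one> \<odot>\<^bsub>M\<^esub> x = x"

text \<open>
  Homomorphisms are extensional functions, so that equality of homomorphisms is equality
  in HOL. A submodule \<open>N\<close> of \<open>M\<close>, as a module in its own right, is \<open>M\<lparr>carrier := N\<rparr>\<close>.
\<close>

definition rmod_hom ::
    "('a, 'r) ring_scheme \<Rightarrow> ('a, 'b, 'm) module_scheme \<Rightarrow> ('a, 'c, 'n) module_scheme \<Rightarrow> ('b \<Rightarrow> 'c) set"
  where "rmod_hom R M N =
    {f \<in> carrier M \<rightarrow>\<^sub>E carrier N.
      (\<forall>x\<in>carrier M. \<forall>y\<in>carrier M. f (x \<oplus>\<^bsub>M\<^esub> y) = f x \<oplus>\<^bsub>N\<^esub> f y) \<and>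
      (\<forall>a\<in>carrier R. \<forall>x\<in>carrier M. f (a \<odot>\<^bsub>M\<^esub> x) = a \<odot>\<^bsub>N\<^esub> f x)}"

definition endo_ring ::
    "('a, 'r) ring_scheme \<Rightarrow> ('a, 'b, 'm) module_scheme \<Rightarrow> ('b \<Rightarrow> 'b) ring"
  where "endo_ring R M =
    \<lparr>carrier = rmod_hom R M M,
     monoid.mult = (\<lambda>f g. compose (carrier M) f g),
     one = (\<lambda>x\<in>carrier M. x),
     ring.zero = (\<lambda>x\<in>carrier M. \<zero>\<^bsub>M\<^esub>),
     ring.add = (\<lambda>f g. \<lambda>x\<in>carrier M. f x \<oplus>\<^bsub>M\<^esub> g x)\<rparr>"

definition rmod_iso ::
    "('a, 'r) ring_scheme \<Rightarrow> ('a, 'b, 'm) module_scheme \<Rightarrow> ('a, 'c, 'n) module_scheme \<Rightarrow> bool"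
  where "rmod_iso R M N \<longleftrightarrow> (\<exists>f\<in>rmod_hom R M N. bij_betw f (carrier M) (carrier N))"

text \<open>The sum of a family of submodules, as the set of all finite sums of members.\<close>

definition submodule_sum :: "('a, 'b, 'm) module_scheme \<Rightarrow> 'i set \<Rightarrow> ('i \<Rightarrow> 'b set) \<Rightarrow> 'b set"
  where "submodule_sum M I A = {finsum M x F | x F. finite F \<and> F \<subseteq> I \<and> x \<in> Pi F A}"

definition self_generator :: "('a, 'r) ring_scheme \<Rightarrow> ('a, 'b, 'm) module_scheme \<Rightarrow> bool"
  where "self_generator R M \<longleftrightarrow>
    (\<forall>N. submodule N R M \<longrightarrow>
      N = submodule_sum M (rmod_hom R M (M\<lparr>carrier := N\<rparr>)) (\<lambda>f. f ` carrier M))"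

definition essential_submodule ::
    "('a, 'r) ring_scheme \<Rightarrow> ('a, 'b, 'm) module_scheme \<Rightarrow> 'b set \<Rightarrow> 'b set \<Rightarrow> bool"
  where "essential_submodule R M N K \<longleftrightarrow>
    submodule N R M \<and> submodule K R M \<and> N \<subseteq> K \<and>
    (\<forall>L. submodule L R M \<and> L \<subseteq> K \<and> N \<inter> L = {\<zero>\<^bsub>M\<^esub>} \<longrightarrow> L = {\<zero>\<^bsub>M\<^esub>})"

definition direct_summand ::
    "('a, 'r) ring_scheme \<Rightarrow> ('a, 'b, 'm) module_scheme \<Rightarrow> 'b set \<Rightarrow> bool"
  where "direct_summand R M N \<longleftrightarrow>
    submodule N R M \<and>
    (\<exists>K. submodule K R M \<and> N \<inter> K = {\<zero>\<^bsub>M\<^esub>} \<and> N <+>\<^bsub>M\<^esub> K = carrier M)"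

definition Delta :: "('a, 'r) ring_scheme \<Rightarrow> ('a, 'b, 'm) module_scheme \<Rightarrow> ('b \<Rightarrow> 'b) set"
  where "Delta R M =
    {f \<in> carrier (endo_ring R M). essential_submodule R M (a_kernel M M f) (carrier M)}"

definition CS_Rickart :: "('a, 'r) ring_scheme \<Rightarrow> ('a, 'b, 'm) module_scheme \<Rightarrow> bool"
  where "CS_Rickart R M \<longleftrightarrow>
    (\<forall>f\<in>carrier (endo_ring R M).
      \<exists>D. direct_summand R M D \<and> essential_submodule R M (a_kernel M M f) D)"

definition C2_module :: "('a, 'r) ring_scheme \<Rightarrow> ('a, 'b, 'm) module_scheme \<Rightarrow> bool"
  where "C2_module R M \<longleftrightarrow>
    (\<forall>N D. submodule N R M \<and> direct_summand R M D \<and>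
        rmod_iso R (M\<lparr>carrier := N\<rparr>) (M\<lparr>carrier := D\<rparr>) \<longrightarrow>
      direct_summand R M N)"

locale right_ideal = additive_subgroup I S + ring S for I and S (structure) +
  assumes I_r_closed: "\<lbrakk>a \<in> I; x \<in> carrier S\<rbrakk> \<Longrightarrow> a \<otimes> x \<in> I"

locale maximal_right_ideal = right_ideal +
  assumes I_notcarr: "I \<noteq> carrier S"
    and I_maximal: "\<lbrakk>right_ideal J S; I \<subseteq> J\<rbrakk> \<Longrightarrow> J = I \<or> J = carrier S"

text \<open>
  The intersection with the carrier matters only for the zero ring, which has no maximal right
  ideals and is its own radical.
\<close>

definition jacobson_radical :: "('a, 'r) ring_scheme \<Rightarrow> 'a set"
  where "jacobson_radical S = carrier S \<inter> \<Inter>{I. maximal_right_ideal I S}"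

locale von_neumann_regular_ring = ring S for S (structure) +
  assumes regular: "a \<in> carrier S \<Longrightarrow> \<exists>b\<in>carrier S. a = a \<otimes> b \<otimes> a"

definition idempotents_lift :: "('a, 'r) ring_scheme \<Rightarrow> 'a set \<Rightarrow> bool"
  where "idempotents_lift S I \<longleftrightarrow>
    (\<forall>x\<in>carrier S. x \<otimes>\<^bsub>S\<^esub> x \<ominus>\<^bsub>S\<^esub> x \<in> I \<longrightarrow>
      (\<exists>e\<in>carrier S. e \<otimes>\<^bsub>S\<^esub> e = e \<and> e \<ominus>\<^bsub>S\<^esub> x \<in> I))"

locale semiregular_ring = ring S for S (structure) +
  assumes quotient_regular: "von_neumann_regular_ring (S Quot (jacobson_radical S))"
    and idempotents_lift: "idempotents_lift S (jacobson_radical S)"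

end

theory Submission
  imports Defs
begin

text \<open>
  Let \<open>S\<close> be the endomorphism ring. If the Jacobson radical \<open>J\<close> is \<open>\<Delta>(S)\<close>, semiregularity amounts
  to the condition (*) that every \<open>f \<in> S\<close> has a multiple \<open>b f\<close> which is idempotent and satisfies
  \<open>f - f b f \<in> \<Delta>(S)\<close>.

  Given (*), \<open>Ker f\<close> is essential in the summand \<open>Ker (b f)\<close>. If moreover \<open>Ker f\<close> is itself a summand,
  then \<open>Ker f = Ker (b f)\<close>, so \<open>f b f = f\<close> and \<open>f b\<close> is an idempotent with the same image as \<open>f\<close>;
  applied to the composition of a projection with an isomorphism \<open>D \<cong> N\<close> this gives C2.

  Conversely, let \<open>Ker f\<close> be essential in \<open>D\<close>, where \<open>M = D \<oplus> E\<close>. Then \<open>f\<close> is injective on \<open>E\<close>, so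
  \<open>f E\<close> is a summand by C2 and some \<open>b\<close> inverts \<open>f\<close> on \<open>E\<close>; followed by the projection onto \<open>E\<close> it
  witnesses (*). Since \<open>1 - d\<close> is injective with essential image for \<open>d \<in> \<Delta>(S)\<close>, C2 makes it
  invertible, whence \<open>\<Delta>(S) \<subseteq> J\<close>. For \<open>a \<in> J\<close> the element \<open>(1 - a b) a = a - a b a\<close> lies in \<open>\<Delta>(S)\<close>
  and \<open>1 - a b\<close> is a unit, whence \<open>J \<subseteq> \<Delta>(S)\<close>.
\<close>

subsection \<open>Semiregularity through idempotent multiples\<close>

text \<open>Two cosets of \<open>I\<close> coincide exactly when their representatives differ by a
  member of \<open>I\<close>, so an equation in the quotient becomes a membership in
  \<open>I\<close>.\<close>

lemma (in ideal) quotient_regular_iff: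
  "von_neumann_regular_ring (R Quot I) \<longleftrightarrow>
    (\<forall>a\<in>carrier R. \<exists>b\<in>carrier R. a \<ominus> a \<otimes> b \<otimes> a \<in> I)"
proof -
  have carr: "carrier (R Quot I) = (\<lambda>a. I +> a) ` carrier R"
    by (auto simp: FactRing_def A_RCOSETS_def')
  have mult: "(I +> a) \<otimes>\<^bsub>R Quot I\<^esub> (I +> b) = I +> a \<otimes> b"
    if "a \<in> carrier R" "b \<in> carrier R" for a b
    using that by (simp add: FactRing_def rcoset_mult_add)
  have "von_neumann_regular_ring (R Quot I) \<longleftrightarrow>
    (\<forall>a\<in>carrier (R Quot I). \<exists>b\<in>carrier (R Quot I).
      a = a \<otimes>\<^bsub>R Quot I\<^esub> b \<otimes>\<^bsub>R Quot I\<^esub> a)"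
    by (auto simp: von_neumann_regular_ring_def von_neumann_regular_ring_axioms_def
        quotient_is_ring)
  also have "\<dots> \<longleftrightarrow> (\<forall>a\<in>carrier R. \<exists>b\<in>carrier R. I +> a = I +> a \<otimes> b \<otimes> a)"
    by (simp add: carr mult)
  also have "\<dots> \<longleftrightarrow> (\<forall>a\<in>carrier R. \<exists>b\<in>carrier R. a \<ominus> a \<otimes> b \<otimes> a \<in> I)"
    by (intro ball_cong bex_cong refl)
      (simp add: quotient_eq_iff_same_a_r_cos[OF is_ideal])
  finally show ?thesis .
qed

text \<open>Modulo \<open>I\<close> the element \<open>b a\<close> is idempotent, and an idempotent
  lift \<open>e\<close> satisfies \<open>e (1 - d) = e b a\<close> for \<open>d = e - b a\<close>.
  The conjugate of \<open>e\<close> by the unit \<open>1 - d\<close> is thus a left multiple of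
  \<open>a\<close>, with multiplier \<open>c = v e b\<close> where \<open>v\<close> inverts
  \<open>1 - d\<close>.\<close>

lemma (in ideal) idempotent_multiple_of_regular_lifting:
  assumes units: "\<And>i. i \<in> I \<Longrightarrow> \<one> \<ominus> i \<in> Units R"
    and lift: "idempotents_lift R I"
    and a: "a \<in> carrier R" and b: "b \<in> carrier R" and reg: "a \<ominus> a \<otimes> b \<otimes> a \<in> I"
  obtains c where "c \<in> carrier R" "c \<otimes> a \<otimes> (c \<otimes> a) = c \<otimes> a" "a \<ominus> a \<otimes> (c \<otimes> a) \<in> I"
proof -
  have "(b \<otimes> a) \<otimes> (b \<otimes> a) \<ominus> b \<otimes> a = \<ominus> (b \<otimes> (a \<ominus> a \<otimes> b \<otimes> a))"
    using a b by algebra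
  also have "\<dots> \<in> I"
    using reg b by (simp add: I_l_closed)
  finally obtain e where e: "e \<in> carrier R" "e \<otimes> e = e" and d: "e \<ominus> b \<otimes> a \<in> I"
    using lift a b unfolding idempotents_lift_def by blast
  define d where "d = e \<ominus> b \<otimes> a"
  have dI: "d \<in> I" and dc: "d \<in> carrier R"
    using d a b e by (auto simp: d_def)
  define v where "v = inv (\<one> \<ominus> d)"
  have v: "v \<in> carrier R" and vl: "v \<otimes> (\<one> \<ominus> d) = \<one>" and vr: "(\<one> \<ominus> d) \<otimes> v = \<one>"
    using units[OF dI] by (auto simp: v_def)
  have ed: "e \<otimes> (\<one> \<ominus> d) = e \<otimes> b \<otimes> a"
  proof -
    have "e \<otimes> (\<one> \<ominus> d) = e \<ominus> e \<otimes> e \<oplus> e \<otimes> b \<otimes> a"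
      unfolding d_def using a b e(1) by (algebra, simp)
    also have "\<dots> = e \<otimes> b \<otimes> a"
      unfolding e(2) using a b e(1) by algebra
    finally show ?thesis .
  qed
  \<comment> \<open>\<open>c a\<close> is the conjugate of the lifted idempotent \<open>e\<close> by the unit \<open>1 - d\<close>\<close>
  define c where "c = v \<otimes> e \<otimes> b"
  have c: "c \<in> carrier R"
    using v e b by (simp add: c_def)
  have ca: "c \<otimes> a = v \<otimes> e \<otimes> (\<one> \<ominus> d)"
    using a b v e dc by (simp add: c_def m_assoc ed)
  have "c \<otimes> a \<otimes> (c \<otimes> a) = v \<otimes> (e \<otimes> (((\<one> \<ominus> d) \<otimes> v) \<otimes> (e \<otimes> (\<one> \<ominus> d))))"
    unfolding ca using v e(1) dc by (simp add: m_assoc)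
  also have "\<dots> = v \<otimes> ((e \<otimes> e) \<otimes> (\<one> \<ominus> d))"
    unfolding vr using v e(1) dc by (simp add: m_assoc)
  also have "\<dots> = c \<otimes> a"
    unfolding ca e(2) using v e(1) dc by (simp add: m_assoc)
  finally have idem: "c \<otimes> a \<otimes> (c \<otimes> a) = c \<otimes> a" .
  \<comment> \<open>\<open>v\<close> is congruent to \<open>1\<close> and \<open>e\<close> to
    \<open>b a\<close>; these two congruences, written as exact equations, make \<open>a c a\<close>
    computable modulo \<open>I\<close>.\<close>
  have v1: "v = \<one> \<oplus> v \<otimes> d"
  proof -
    have "v = v \<otimes> (\<one> \<ominus> d) \<oplus> v \<otimes> d"
      using v dc by (algebra, simp)
    then show ?thesis by (simp add: vl)
  qed
  have e1: "e = d \<oplus> b \<otimes> a"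
    unfolding d_def using a b e(1) by algebra
  have "a \<otimes> (c \<otimes> a) = a \<otimes> (\<one> \<oplus> v \<otimes> d) \<otimes> e \<otimes> b \<otimes> a"
    unfolding c_def v1[symmetric] using a b v e(1) by (simp add: m_assoc)
  also have "\<dots> = a \<otimes> e \<otimes> b \<otimes> a \<oplus> a \<otimes> v \<otimes> d \<otimes> e \<otimes> b \<otimes> a"
    using a b v dc e(1) by algebra
  also have "a \<otimes> e \<otimes> b \<otimes> a = a \<otimes> d \<otimes> b \<otimes> a \<oplus> a \<otimes> b \<otimes> a \<otimes> b \<otimes> a"
    unfolding e1 using a b dc by algebra
  \<comment> \<open>The term \<open>a b a\<close> is added and subtracted, so that every summand has
    a factor \<open>a - a b a\<close> or \<open>d\<close>, both in \<open>I\<close>.\<close>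
  finally have "a \<ominus> a \<otimes> (c \<otimes> a) = (a \<ominus> a \<otimes> b \<otimes> a) \<oplus> (a \<ominus> a \<otimes> b \<otimes> a) \<otimes> b \<otimes> a
      \<ominus> a \<otimes> d \<otimes> b \<otimes> a \<ominus> a \<otimes> v \<otimes> d \<otimes> e \<otimes> b \<otimes> a"
    using a b v dc e(1) by algebra
  also have "\<dots> \<in> I"
    using reg dI a b v e(1) unfolding a_minus_def
    by (simp add: I_l_closed I_r_closed)
  finally show ?thesis
    using that c idem by blast
qed

text \<open>Lifting comes out of the multiples themselves: \<open>b x\<close> is an exact
  idempotent, and adding a suitable term of square zero moves it into the class of
  \<open>x\<close>.\<close>

lemma (in ideal) idempotents_lift_if_idempotent_multiples:
  assumes mult: "\<And>a. a \<in> carrier R \<Longrightarrow>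
    \<exists>b\<in>carrier R. b \<otimes> a \<otimes> (b \<otimes> a) = b \<otimes> a \<and> a \<ominus> a \<otimes> (b \<otimes> a) \<in> I"
  shows "idempotents_lift R I"
  unfolding idempotents_lift_def
proof (intro ballI impI)
  fix x assume x: "x \<in> carrier R" and xI: "x \<otimes> x \<ominus> x \<in> I"
  obtain b where b: "b \<in> carrier R" and idem: "b \<otimes> x \<otimes> (b \<otimes> x) = b \<otimes> x"
    and yI: "x \<ominus> x \<otimes> (b \<otimes> x) \<in> I"
    using mult[OF x] by blast
  define f where "f = b \<otimes> x"
  have f: "f \<in> carrier R" and ff: "f \<otimes> f = f" and fI: "x \<ominus> x \<otimes> f \<in> I"
    using b x idem yI by (auto simp: f_def)
  \<comment> \<open>\<open>e = f + (1 - f) x f\<close>; modulo \<open>I\<close> we have \<open>f x = f\<close> and \<open>x f = x\<close>, hence \<open>e = x\<close>\<close>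
  define e where "e = f \<oplus> (x \<otimes> f \<ominus> f \<otimes> x \<otimes> f)"
  have e: "e \<in> carrier R"
    using f x by (simp add: e_def)
  have ze: "f \<otimes> (x \<otimes> f \<ominus> f \<otimes> x \<otimes> f) = \<zero>"
  proof -
    have "f \<otimes> (x \<otimes> f \<ominus> f \<otimes> x \<otimes> f) = f \<otimes> x \<otimes> f \<ominus> f \<otimes> f \<otimes> x \<otimes> f"
      using f x by algebra
    then show ?thesis
      unfolding ff using f x by (simp add: a_minus_def r_neg)
  qed
  have zf: "(x \<otimes> f \<ominus> f \<otimes> x \<otimes> f) \<otimes> f = x \<otimes> f \<ominus> f \<otimes> x \<otimes> f"
  proof -
    have "(x \<otimes> f \<ominus> f \<otimes> x \<otimes> f) \<otimes> f = x \<otimes> (f \<otimes> f) \<ominus> f \<otimes> x \<otimes> (f \<otimes> f)"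
      using f x by algebra
    then show ?thesis
      unfolding ff .
  qed
  define z where "z = x \<otimes> f \<ominus> f \<otimes> x \<otimes> f"
  have z: "z \<in> carrier R" "f \<otimes> z = \<zero>" "z \<otimes> f = z"
    using f x ze zf by (auto simp: z_def)
  \<comment> \<open>\<open>z z = z f z\<close>, and \<open>f z\<close> vanishes. In the square of
    \<open>f + z\<close> only \<open>f f\<close> and \<open>z f\<close> then survive, so it is
    idempotent.\<close>
  have zz: "z \<otimes> z = \<zero>"
    by (metis z f m_assoc r_null)
  have idem_e: "e \<otimes> e = e"
    using z f by (simp add: e_def z_def[symmetric] l_distr r_distr ff zz)
  \<comment> \<open>Multiplying \<open>x x - x\<close> by \<open>b\<close> on the left and by
    \<open>f\<close> on the right turns the hypothesis on \<open>x\<close> into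
    \<open>f x f - f\<close> in \<open>I\<close>.\<close>
  have "b \<otimes> (x \<otimes> x \<ominus> x) \<otimes> f = f \<otimes> x \<otimes> f \<ominus> f \<otimes> f"
    unfolding f_def using b x by algebra
  then have "e \<ominus> x = \<ominus> (b \<otimes> (x \<otimes> x \<ominus> x) \<otimes> f) \<ominus> (x \<ominus> x \<otimes> f)"
    unfolding ff e_def using f x by algebra
  also have "\<dots> \<in> I"
    using xI fI b f unfolding a_minus_def by (simp add: I_l_closed I_r_closed)
  finally show "\<exists>e\<in>carrier R. e \<otimes> e = e \<and> e \<ominus> x \<in> I"
    using e idem_e by blast
qed

section \<open>Right ideals and the Jacobson radical\<close>

lemma right_ideal_subset: "right_ideal I S \<Longrightarrow> I \<subseteq> carrier S"
  by (simp add: right_ideal_def additive_subgroup.a_subset)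

context ring
begin

text \<open>Negatives are multiples by \<open>- 1\<close>, so closure under right multiplication
  supplies them.\<close>

lemma right_idealI:
  assumes "I \<subseteq> carrier R" "\<zero> \<in> I"
    and "\<And>x y. x \<in> I \<Longrightarrow> y \<in> I \<Longrightarrow> x \<oplus> y \<in> I"
    and "\<And>x y. x \<in> I \<Longrightarrow> y \<in> carrier R \<Longrightarrow> x \<otimes> y \<in> I"
  shows "right_ideal I R"
proof -
  have "\<ominus> x \<in> I" if "x \<in> I" for x
    using assms(4)[OF that, of "\<ominus> \<one>"] that assms(1) by (auto simp: r_minus)
  then have "subgroup I (add_monoid R)"
    using assms by (intro add.subgroupI) (auto simp: a_inv_def)
  then show ?thesis
    using assms(4) ring_axioms
    by (simp add: right_ideal_def right_ideal_axioms_def additive_subgroup_def)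
qed

lemma right_ideal_eq_carrier:
  assumes "right_ideal I R" "\<one> \<in> I"
  shows "I = carrier R"
proof -
  interpret right_ideal I R by fact
  show ?thesis
    using I_r_closed[OF assms(2)] a_subset by auto
qed

lemma principal_right_ideal:
  assumes "a \<in> carrier R"
  shows "right_ideal ((\<otimes>) a ` carrier R) R"
proof (rule right_idealI)
  show "\<zero> \<in> (\<otimes>) a ` carrier R"
    using assms by (force intro: image_eqI[of _ _ \<zero>])
  show "x \<oplus> y \<in> (\<otimes>) a ` carrier R" if "x \<in> (\<otimes>) a ` carrier R" "y \<in> (\<otimes>) a ` carrier R" for x y
    using that assms by (auto simp: r_distr[symmetric])
  show "x \<otimes> y \<in> (\<otimes>) a ` carrier R" if "x \<in> (\<otimes>) a ` carrier R" "y \<in> carrier R" for x y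
    using that assms by (auto simp: m_assoc)
qed (use assms in auto)

lemma right_ideal_set_add:
  assumes "right_ideal I R" "right_ideal J R"
  shows "right_ideal (I <+>\<^bsub>R\<^esub> J) R"
proof -
  interpret I: right_ideal I R by fact
  interpret J: right_ideal J R by fact
  have mem: "x \<in> I <+>\<^bsub>R\<^esub> J \<longleftrightarrow> (\<exists>i\<in>I. \<exists>j\<in>J. x = i \<oplus> j)" for x
    unfolding set_add_def' by blast
  show ?thesis
  proof (rule right_idealI)
    show "\<zero> \<in> I <+>\<^bsub>R\<^esub> J"
      using I.zero_closed J.zero_closed r_zero[OF zero_closed] by (metis mem)
    show "x \<oplus> y \<in> I <+>\<^bsub>R\<^esub> J" if xy: "x \<in> I <+>\<^bsub>R\<^esub> J" "y \<in> I <+>\<^bsub>R\<^esub> J" for x y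
    proof -
      obtain i j i' j' where *: "i \<in> I" "j \<in> J" "i' \<in> I" "j' \<in> J" "x = i \<oplus> j" "y = i' \<oplus> j'"
        using xy unfolding mem by blast
      have "x \<oplus> y = (i \<oplus> i') \<oplus> (j \<oplus> j')"
        unfolding *(5,6) using *(1-4) by (simp add: a_ac)
      then show ?thesis
        unfolding mem using * I.a_closed J.a_closed by blast
    qed
    show "x \<otimes> y \<in> I <+>\<^bsub>R\<^esub> J" if xy: "x \<in> I <+>\<^bsub>R\<^esub> J" "y \<in> carrier R" for x y
    proof -
      obtain i j where *: "i \<in> I" "j \<in> J" "x = i \<oplus> j"
        using xy unfolding mem by blast
      then have "x \<otimes> y = i \<otimes> y \<oplus> j \<otimes> y"
        using xy(2) by (simp add: l_distr)
      then show ?thesis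
        unfolding mem using * xy(2) I.I_r_closed J.I_r_closed by blast
    qed
    show "I <+>\<^bsub>R\<^esub> J \<subseteq> carrier R"
      using mem by auto
  qed
qed

text \<open>Zorn's lemma on the right ideals that contain \<open>I\<close> and omit
  \<open>1\<close>. A right ideal is proper exactly when it omits \<open>1\<close>, and unions of
  chains inherit this.\<close>

lemma ex_maximal_right_ideal:
  assumes I: "right_ideal I R" and one: "\<one> \<notin> I"
  obtains J where "maximal_right_ideal J R" "I \<subseteq> J"
proof -
  define A where "A = {J. right_ideal J R \<and> I \<subseteq> J \<and> \<one> \<notin> J}"
  have "\<Union> C \<in> A" if ne: "C \<noteq> {}" and ch: "subset.chain A C" for C
  proof -
    have CA: "right_ideal J R" "I \<subseteq> J" "\<one> \<notin> J" if "J \<in> C" for J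
      using that ch unfolding A_def subset.chain_def by auto
    have tot: "J \<subseteq> K \<or> K \<subseteq> J" if "J \<in> C" "K \<in> C" for J K
      using that ch unfolding subset.chain_def by blast
    have "right_ideal (\<Union> C) R"
    proof (rule right_idealI)
      show "\<Union> C \<subseteq> carrier R"
        using CA(1) by (auto dest: right_ideal_subset)
      show "\<zero> \<in> \<Union> C"
        using ne CA(1) by (auto simp: right_ideal_def additive_subgroup.zero_closed)
      show "x \<oplus> y \<in> \<Union> C" if xy: "x \<in> \<Union> C" "y \<in> \<Union> C" for x y
      proof -
        obtain J where "J \<in> C" "x \<in> J" "y \<in> J"
          using xy tot by blast
        then show ?thesis
          using CA(1)[of J] by (auto simp: right_ideal_def intro: additive_subgroup.a_closed)
      qed
      show "x \<otimes> y \<in> \<Union> C" if "x \<in> \<Union> C" "y \<in> carrier R" for x y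
        using that CA(1) by (auto intro: right_ideal.I_r_closed)
    qed
    then show ?thesis
      using CA ne unfolding A_def by blast
  qed
  moreover have "A \<noteq> {}"
    using I one by (auto simp: A_def)
  ultimately obtain J where J: "J \<in> A" and max: "\<And>K. K \<in> A \<Longrightarrow> J \<subseteq> K \<Longrightarrow> K = J"
    using subset_Zorn_nonempty[of A] by blast
  have "maximal_right_ideal J R"
  proof -
    have "J \<noteq> carrier R"
      using J by (auto simp: A_def)
    moreover have "K = J \<or> K = carrier R" if "right_ideal K R" "J \<subseteq> K" for K
      using that max[of K] J right_ideal_eq_carrier unfolding A_def by blast
    ultimately show ?thesis
      using J by (auto simp: A_def maximal_right_ideal_def maximal_right_ideal_axioms_def)
  qed
  then show ?thesis
    using that J by (auto simp: A_def)
qed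

lemma jacobson_radical_mult_closed:
  assumes "a \<in> jacobson_radical R" "b \<in> carrier R"
  shows "a \<otimes> b \<in> jacobson_radical R"
  using assms unfolding jacobson_radical_def
  by (auto simp: maximal_right_ideal_def intro: right_ideal.I_r_closed)

text \<open>First every \<open>1 - x\<close> with \<open>x\<close> in the radical gets a right
  inverse. The right inverse of \<open>1 - a\<close> has this form again, hence is right invertible
  too, and so inverts \<open>1 - a\<close> on both sides.\<close>

lemma jacobson_radical_unit:
  assumes a: "a \<in> jacobson_radical R"
  shows "\<one> \<ominus> a \<in> Units R"
proof -
  have rinv: "\<exists>c\<in>carrier R. (\<one> \<ominus> x) \<otimes> c = \<one>" if x: "x \<in> jacobson_radical R" for x
  proof (rule ccontr)
    assume no: "\<not> ?thesis"
    have xc: "x \<in> carrier R"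
      using x by (simp add: jacobson_radical_def)
    \<comment> \<open>Without a right inverse, the right ideal generated by \<open>1 - x\<close>
      lies in a maximal one, which contains \<open>x\<close> as well and therefore
      \<open>1\<close>.\<close>
    have "right_ideal ((\<otimes>) (\<one> \<ominus> x) ` carrier R) R" "\<one> \<notin> (\<otimes>) (\<one> \<ominus> x) ` carrier R"
      using no xc by (auto intro: principal_right_ideal)
    then obtain J where J: "maximal_right_ideal J R" "(\<otimes>) (\<one> \<ominus> x) ` carrier R \<subseteq> J"
      by (rule ex_maximal_right_ideal)
    interpret maximal_right_ideal J R by (rule J)
    have "(\<one> \<ominus> x) \<otimes> \<one> \<in> J" "x \<in> J"
      using J x xc by (auto simp: jacobson_radical_def simp del: r_one)
    then have "(\<one> \<ominus> x) \<otimes> \<one> \<oplus> x \<in> J"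
      by (rule a_closed)
    also have "(\<one> \<ominus> x) \<otimes> \<one> \<oplus> x = \<one>"
      using xc by (simp add: a_minus_def a_assoc l_neg)
    finally show False
      using right_ideal_eq_carrier I_notcarr right_ideal_axioms by blast
  qed
  have ac: "a \<in> carrier R"
    using a by (simp add: jacobson_radical_def)
  obtain c where c: "c \<in> carrier R" "(\<one> \<ominus> a) \<otimes> c = \<one>"
    using rinv[OF a] by blast
  \<comment> \<open>\<open>(1 - a) c = 1\<close> reads \<open>c = 1 - a (- c)\<close>, and
    \<open>a (- c)\<close> stays in the radical.\<close>
  have "\<one> \<ominus> a \<otimes> (\<ominus> c) = (\<one> \<ominus> a) \<otimes> c \<oplus> a \<otimes> c"
    unfolding c(2) using ac c(1) by algebra
  also have "\<dots> = c"
    using ac c(1) by algebra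
  finally have "\<one> \<ominus> a \<otimes> (\<ominus> c) = c" .
  then obtain d where d: "d \<in> carrier R" "c \<otimes> d = \<one>"
    using rinv[OF jacobson_radical_mult_closed[OF a, of "\<ominus> c"]] c(1) by auto
  \<comment> \<open>\<open>c\<close> has the left inverse \<open>1 - a\<close> and the right inverse
    \<open>d\<close>, so these coincide.\<close>
  have "d = ((\<one> \<ominus> a) \<otimes> c) \<otimes> d"
    using c d by simp
  also have "\<dots> = \<one> \<ominus> a"
    using c(1) d ac by (simp only: m_assoc minus_closed one_closed r_one)
  finally have "d = \<one> \<ominus> a" .
  then show ?thesis
    using c d ac unfolding Units_def by auto
qed

text \<open>A maximal right ideal \<open>J\<close> omitting \<open>d\<close> would give
  \<open>1 = j + d s\<close> with \<open>j\<close> in \<open>J\<close>. Then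
  \<open>j = 1 - d s\<close> is a unit, since \<open>d s\<close> is in \<open>D\<close>, and
  \<open>J\<close> would be everything.\<close>

lemma ideal_subset_jacobson_radical:
  assumes D: "ideal D R" and units: "\<And>d. d \<in> D \<Longrightarrow> \<one> \<ominus> d \<in> Units R"
  shows "D \<subseteq> jacobson_radical R"
proof
  interpret D: ideal D R by fact
  fix d assume d: "d \<in> D"
  have "d \<in> J" if J: "maximal_right_ideal J R" for J
  proof (rule ccontr)
    assume dJ: "d \<notin> J"
    interpret J: maximal_right_ideal J R by fact
    define K where "K = J <+>\<^bsub>R\<^esub> (\<otimes>) d ` carrier R"
    have K: "right_ideal K R"
      unfolding K_def using d
      by (intro right_ideal_set_add principal_right_ideal J.right_ideal_axioms) auto
    have "j \<oplus> d \<otimes> s \<in> K" if "j \<in> J" "s \<in> carrier R" for j s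
      using that unfolding K_def set_add_def' by blast
    \<comment> \<open>The choice \<open>s = 0\<close> recovers \<open>J\<close>;
      \<open>j = 0\<close> with \<open>s = 1\<close> recovers \<open>d\<close>.\<close>
    from this[of _ \<zero>] this[of \<zero> \<one>] have "J \<subseteq> K" "d \<in> K"
      using d J.zero_closed by auto
    then have "\<one> \<in> K"
      using J.I_maximal[OF K] dJ by auto
    then obtain j s where js: "j \<in> J" "s \<in> carrier R" "\<one> = j \<oplus> d \<otimes> s"
      unfolding K_def set_add_def' by auto
    have "\<one> \<ominus> d \<otimes> s = j"
      unfolding js(3) using js(1,2) d by (simp add: a_minus_def a_assoc r_neg)
    then have "j \<in> Units R"
      using units[OF D.I_r_closed[OF d js(2)]] by simp
    then have "\<one> \<in> J"
      using J.I_r_closed[OF js(1), of "inv j"] by simp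
    then show False
      using right_ideal_eq_carrier[OF J.right_ideal_axioms] J.I_notcarr by simp
  qed
  then show "d \<in> jacobson_radical R"
    using d by (simp add: jacobson_radical_def)
qed

theorem semiregular_ring_iff:
  assumes "ideal (jacobson_radical R) R"
  shows "semiregular_ring R \<longleftrightarrow>
    (\<forall>a\<in>carrier R. \<exists>b\<in>carrier R.
      b \<otimes> a \<otimes> (b \<otimes> a) = b \<otimes> a \<and> a \<ominus> a \<otimes> (b \<otimes> a) \<in> jacobson_radical R)"
proof -
  interpret J: ideal "jacobson_radical R" R by fact
  have "semiregular_ring R \<longleftrightarrow>
      (\<forall>a\<in>carrier R. \<exists>b\<in>carrier R. a \<ominus> a \<otimes> b \<otimes> a \<in> jacobson_radical R) \<and>
      idempotents_lift R (jacobson_radical R)"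
    by (simp add: semiregular_ring_def semiregular_ring_axioms_def J.quotient_regular_iff
        ring_axioms)
  also have "\<dots> \<longleftrightarrow> (\<forall>a\<in>carrier R. \<exists>b\<in>carrier R.
      b \<otimes> a \<otimes> (b \<otimes> a) = b \<otimes> a \<and> a \<ominus> a \<otimes> (b \<otimes> a) \<in> jacobson_radical R)" (is "?L \<longleftrightarrow> ?R")
  proof
    assume ?L
    then show ?R
      by (metis J.idempotent_multiple_of_regular_lifting jacobson_radical_unit)
  next
    assume R: ?R
    then have "idempotents_lift R (jacobson_radical R)"
      by (intro J.idempotents_lift_if_idempotent_multiples) blast
    with R show ?L
      by (metis m_assoc)
  qed
  finally show ?thesis .
qed

end

subsection \<open>Endomorphisms and direct summands\<close>

context right_module
begin

lemma smult_zero [simp]: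
  assumes "a \<in> carrier R"
  shows "a \<odot>\<^bsub>M\<^esub> \<zero>\<^bsub>M\<^esub> = \<zero>\<^bsub>M\<^esub>"
  using smult_r_distr[OF assms, of "\<zero>\<^bsub>M\<^esub>" "\<zero>\<^bsub>M\<^esub>"] assms by simp

lemma zero_smult [simp]:
  assumes "x \<in> carrier M"
  shows "\<zero> \<odot>\<^bsub>M\<^esub> x = \<zero>\<^bsub>M\<^esub>"
  using smult_l_distr[of \<zero> \<zero> x] assms by simp

lemma smult_minus:
  assumes "a \<in> carrier R" "x \<in> carrier M"
  shows "a \<odot>\<^bsub>M\<^esub> (\<ominus>\<^bsub>M\<^esub> x) = \<ominus>\<^bsub>M\<^esub> (a \<odot>\<^bsub>M\<^esub> x)"
  using smult_r_distr[of a "\<ominus>\<^bsub>M\<^esub> x" x] assms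
  by (metis M.a_inv_closed M.l_neg M.minus_equality smult_closed smult_zero)

lemma minus_one_smult:
  assumes "x \<in> carrier M"
  shows "(\<ominus> \<one>) \<odot>\<^bsub>M\<^esub> x = \<ominus>\<^bsub>M\<^esub> x"
  using smult_l_distr[of "\<ominus> \<one>" \<one> x] assms
  by (simp add: R.l_neg) (metis M.minus_equality R.a_inv_closed R.one_closed smult_closed)

lemma minus_eq_zero_iff [simp]:
  assumes "x \<in> carrier M" "y \<in> carrier M"
  shows "x \<ominus>\<^bsub>M\<^esub> y = \<zero>\<^bsub>M\<^esub> \<longleftrightarrow> x = y"
  using assms by (metis M.add.inv_closed M.minus_equality M.minus_minus M.r_neg a_minus_def)

lemma add_minus_add_cancel:
  assumes "x \<in> carrier M" "y \<in> carrier M" "z \<in> carrier M"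
  shows "(x \<oplus>\<^bsub>M\<^esub> z) \<ominus>\<^bsub>M\<^esub> (y \<oplus>\<^bsub>M\<^esub> z) = x \<ominus>\<^bsub>M\<^esub> y"
  using assms M.a_comm[of "\<ominus>\<^bsub>M\<^esub> y" "\<ominus>\<^bsub>M\<^esub> z"]
  by (simp add: a_minus_def M.minus_add M.a_assoc M.r_neg2)

text \<open>As for right ideals, negatives are multiples by \<open>- 1\<close>.\<close>

lemma submoduleI:
  assumes "N \<subseteq> carrier M" "\<zero>\<^bsub>M\<^esub> \<in> N"
    and "\<And>x y. x \<in> N \<Longrightarrow> y \<in> N \<Longrightarrow> x \<oplus>\<^bsub>M\<^esub> y \<in> N"
    and "\<And>a x. a \<in> carrier R \<Longrightarrow> x \<in> N \<Longrightarrow> a \<odot>\<^bsub>M\<^esub> x \<in> N"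
  shows "submodule N R M"
proof -
  have "\<ominus>\<^bsub>M\<^esub> x \<in> N" if "x \<in> N" for x
    using assms(4)[of "\<ominus> \<one>" x] that assms(1) by (auto simp: minus_one_smult)
  then have "subgroup N (add_monoid M)"
    using assms by (intro M.add.subgroupI) (auto simp: a_inv_def)
  then show ?thesis
    using assms(4) by (simp add: submodule_def submodule_axioms_def)
qed

lemma
  assumes "submodule N R M"
  shows submodule_subset: "N \<subseteq> carrier M"
    and submodule_zero: "\<zero>\<^bsub>M\<^esub> \<in> N"
    and submodule_add: "\<And>x y. x \<in> N \<Longrightarrow> y \<in> N \<Longrightarrow> x \<oplus>\<^bsub>M\<^esub> y \<in> N"
    and submodule_smult: "\<And>a x. a \<in> carrier R \<Longrightarrow> x \<in> N \<Longrightarrow> a \<odot>\<^bsub>M\<^esub> x \<in> N"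
    and submodule_minus: "\<And>x. x \<in> N \<Longrightarrow> \<ominus>\<^bsub>M\<^esub> x \<in> N"
proof -
  interpret submodule N R M by fact
  show "N \<subseteq> carrier M" "\<zero>\<^bsub>M\<^esub> \<in> N"
    and add: "\<And>x y. x \<in> N \<Longrightarrow> y \<in> N \<Longrightarrow> x \<oplus>\<^bsub>M\<^esub> y \<in> N"
    and smult: "\<And>a x. a \<in> carrier R \<Longrightarrow> x \<in> N \<Longrightarrow> a \<odot>\<^bsub>M\<^esub> x \<in> N"
    using subset one_closed m_closed by auto
  show "\<ominus>\<^bsub>M\<^esub> x \<in> N" if "x \<in> N" for x
    using smult[of "\<ominus> \<one>" x, OF _ that] minus_one_smult[OF subsetD[OF subset that, simplified]]
    by (metis R.a_inv_closed R.one_closed)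
qed

lemma submodule_carrier: "submodule (carrier M) R M"
  by (rule submoduleI) auto

lemma submodule_Int:
  assumes "submodule N R M" "submodule K R M"
  shows "submodule (N \<inter> K) R M"
  using submodule_subset[OF assms(1)] assms
  by (intro submoduleI) (auto intro: submodule_zero submodule_add submodule_smult)

lemma rmod_hom_restricted:
  "f \<in> rmod_hom R (M\<lparr>carrier := A\<rparr>) (M\<lparr>carrier := B\<rparr>) \<longleftrightarrow>
    f \<in> A \<rightarrow>\<^sub>E B \<and>
    (\<forall>x\<in>A. \<forall>y\<in>A. f (x \<oplus>\<^bsub>M\<^esub> y) = f x \<oplus>\<^bsub>M\<^esub> f y) \<and>
    (\<forall>a\<in>carrier R. \<forall>x\<in>A. f (a \<odot>\<^bsub>M\<^esub> x) = a \<odot>\<^bsub>M\<^esub> f x)"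
  by (simp add: rmod_hom_def)

section \<open>The endomorphism ring\<close>

abbreviation End where "End \<equiv> endo_ring R M"

lemma endo_iff:
  "f \<in> carrier End \<longleftrightarrow>
    f \<in> carrier M \<rightarrow>\<^sub>E carrier M \<and>
    (\<forall>x\<in>carrier M. \<forall>y\<in>carrier M. f (x \<oplus>\<^bsub>M\<^esub> y) = f x \<oplus>\<^bsub>M\<^esub> f y) \<and>
    (\<forall>a\<in>carrier R. \<forall>x\<in>carrier M. f (a \<odot>\<^bsub>M\<^esub> x) = a \<odot>\<^bsub>M\<^esub> f x)"
  by (simp add: endo_ring_def rmod_hom_def)

lemma endo_restrictI:
  assumes "\<And>x. x \<in> carrier M \<Longrightarrow> f x \<in> carrier M"
    and "\<And>x y. x \<in> carrier M \<Longrightarrow> y \<in> carrier M \<Longrightarrow> f (x \<oplus>\<^bsub>M\<^esub> y) = f x \<oplus>\<^bsub>M\<^esub> f y"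
    and "\<And>a x. a \<in> carrier R \<Longrightarrow> x \<in> carrier M \<Longrightarrow> f (a \<odot>\<^bsub>M\<^esub> x) = a \<odot>\<^bsub>M\<^esub> f x"
  shows "(\<lambda>x\<in>carrier M. f x) \<in> carrier End"
  using assms by (simp add: endo_iff)

lemma
  assumes "f \<in> carrier End"
  shows endo_closed [simp]: "x \<in> carrier M \<Longrightarrow> f x \<in> carrier M"
    and endo_add: "x \<in> carrier M \<Longrightarrow> y \<in> carrier M \<Longrightarrow> f (x \<oplus>\<^bsub>M\<^esub> y) = f x \<oplus>\<^bsub>M\<^esub> f y"
    and endo_smult: "a \<in> carrier R \<Longrightarrow> x \<in> carrier M \<Longrightarrow> f (a \<odot>\<^bsub>M\<^esub> x) = a \<odot>\<^bsub>M\<^esub> f x"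
  using assms by (auto simp: endo_iff)

lemma endo_zero [simp]:
  assumes "f \<in> carrier End"
  shows "f \<zero>\<^bsub>M\<^esub> = \<zero>\<^bsub>M\<^esub>"
  using endo_add[OF assms, of "\<zero>\<^bsub>M\<^esub>" "\<zero>\<^bsub>M\<^esub>"] assms by simp

lemma endo_uminus:
  assumes "f \<in> carrier End" "x \<in> carrier M"
  shows "f (\<ominus>\<^bsub>M\<^esub> x) = \<ominus>\<^bsub>M\<^esub> f x"
  using endo_smult[of f "\<ominus> \<one>" x] assms by (simp add: minus_one_smult)

lemma endo_minus:
  assumes "f \<in> carrier End" "x \<in> carrier M" "y \<in> carrier M"
  shows "f (x \<ominus>\<^bsub>M\<^esub> y) = f x \<ominus>\<^bsub>M\<^esub> f y"
  using assms by (simp add: a_minus_def endo_add endo_uminus)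

text \<open>Members of \<open>End\<close> are undefined outside \<open>carrier M\<close>, so their
  values on the carrier determine them and identities can be checked pointwise.\<close>

lemma endo_eqI:
  assumes "f \<in> carrier End" "g \<in> carrier End" "\<And>x. x \<in> carrier M \<Longrightarrow> f x = g x"
  shows "f = g"
  using assms by (auto simp: endo_iff intro: PiE_ext)

lemma endo_mult_apply [simp]: "x \<in> carrier M \<Longrightarrow> (f \<otimes>\<^bsub>End\<^esub> g) x = f (g x)"
  by (simp add: endo_ring_def compose_def)

lemma endo_one_apply [simp]: "x \<in> carrier M \<Longrightarrow> \<one>\<^bsub>End\<^esub> x = x"
  by (simp add: endo_ring_def)

lemma endo_zero_apply [simp]: "x \<in> carrier M \<Longrightarrow> \<zero>\<^bsub>End\<^esub> x = \<zero>\<^bsub>M\<^esub>"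
  by (simp add: endo_ring_def)

lemma endo_add_apply [simp]: "x \<in> carrier M \<Longrightarrow> (f \<oplus>\<^bsub>End\<^esub> g) x = f x \<oplus>\<^bsub>M\<^esub> g x"
  by (simp add: endo_ring_def)

text \<open>The ring laws hold pointwise in \<open>M\<close>; among them, distributivity of a left
  factor over a sum is the one that uses additivity of the maps.\<close>

lemma ring_End: "ring End"
proof -
  have mult: "f \<otimes>\<^bsub>End\<^esub> g \<in> carrier End" if "f \<in> carrier End" "g \<in> carrier End" for f g
  proof -
    have "f \<otimes>\<^bsub>End\<^esub> g = (\<lambda>x\<in>carrier M. f (g x))"
      by (simp add: endo_ring_def compose_def)
    then show ?thesis
      using that by (simp only:) (rule endo_restrictI; simp add: endo_add endo_smult)
  qed
  have one: "\<one>\<^bsub>End\<^esub> \<in> carrier End"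
    using endo_restrictI[of "\<lambda>x. x"] by (simp add: endo_ring_def)
  have zero: "\<zero>\<^bsub>End\<^esub> \<in> carrier End"
    using endo_restrictI[of "\<lambda>x. \<zero>\<^bsub>M\<^esub>"] by (simp add: endo_ring_def)
  have add: "f \<oplus>\<^bsub>End\<^esub> g \<in> carrier End" if "f \<in> carrier End" "g \<in> carrier End" for f g
  proof -
    have "f \<oplus>\<^bsub>End\<^esub> g = (\<lambda>x\<in>carrier M. f x \<oplus>\<^bsub>M\<^esub> g x)"
      by (simp add: endo_ring_def)
    then show ?thesis
      using that
      by (simp only:) (rule endo_restrictI; simp add: endo_add endo_smult smult_r_distr M.a_ac)
  qed
  have inv: "\<exists>g\<in>carrier End. g \<oplus>\<^bsub>End\<^esub> f = \<zero>\<^bsub>End\<^esub>" if f: "f \<in> carrier End" for f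
  proof
    let ?g = "\<lambda>x\<in>carrier M. \<ominus>\<^bsub>M\<^esub> f x"
    show g: "?g \<in> carrier End"
      using f by (intro endo_restrictI) (simp_all add: endo_add endo_smult smult_minus M.minus_add)
    show "?g \<oplus>\<^bsub>End\<^esub> f = \<zero>\<^bsub>End\<^esub>"
      by (rule endo_eqI) (use f g add zero in \<open>simp_all add: M.l_neg\<close>)
  qed
  show ?thesis
  proof (rule ringI)
    show "abelian_group End"
    proof (rule abelian_groupI)
      show "f \<oplus>\<^bsub>End\<^esub> g \<oplus>\<^bsub>End\<^esub> h = f \<oplus>\<^bsub>End\<^esub> (g \<oplus>\<^bsub>End\<^esub> h)"
        if "f \<in> carrier End" "g \<in> carrier End" "h \<in> carrier End" for f g h
        by (rule endo_eqI) (use that add in \<open>simp_all add: M.a_assoc\<close>)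
      show "f \<oplus>\<^bsub>End\<^esub> g = g \<oplus>\<^bsub>End\<^esub> f" if "f \<in> carrier End" "g \<in> carrier End" for f g
        by (rule endo_eqI) (use that add in \<open>simp_all add: M.a_comm\<close>)
      show "\<zero>\<^bsub>End\<^esub> \<oplus>\<^bsub>End\<^esub> f = f" if "f \<in> carrier End" for f
        by (rule endo_eqI) (use that add zero in simp_all)
    qed (use add zero inv in auto)
    show "monoid End"
    proof (rule monoidI)
      show "f \<otimes>\<^bsub>End\<^esub> g \<otimes>\<^bsub>End\<^esub> h = f \<otimes>\<^bsub>End\<^esub> (g \<otimes>\<^bsub>End\<^esub> h)"
        if "f \<in> carrier End" "g \<in> carrier End" "h \<in> carrier End" for f g h
        by (rule endo_eqI) (use that mult in simp_all)
      show "\<one>\<^bsub>End\<^esub> \<otimes>\<^bsub>End\<^esub> f = f" "f \<otimes>\<^bsub>End\<^esub> \<one>\<^bsub>End\<^esub> = f" if "f \<in> carrier End" for f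
        by (rule endo_eqI; use that mult one in simp)+
    qed (use mult one in auto)
    show "(f \<oplus>\<^bsub>End\<^esub> g) \<otimes>\<^bsub>End\<^esub> h = f \<otimes>\<^bsub>End\<^esub> h \<oplus>\<^bsub>End\<^esub> g \<otimes>\<^bsub>End\<^esub> h"
      "h \<otimes>\<^bsub>End\<^esub> (f \<oplus>\<^bsub>End\<^esub> g) = h \<otimes>\<^bsub>End\<^esub> f \<oplus>\<^bsub>End\<^esub> h \<otimes>\<^bsub>End\<^esub> g"
      if "f \<in> carrier End" "g \<in> carrier End" "h \<in> carrier End" for f g h
      by (rule endo_eqI; use that mult add in \<open>simp add: endo_add\<close>)+
  qed
qed

sublocale End: ring End
  by (rule ring_End)

text \<open>The negative in \<open>End\<close> is an abstract group inverse; uniqueness of inverses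
  in \<open>M\<close> identifies it with the pointwise negative.\<close>

lemma endo_uminus_apply [simp]:
  assumes "f \<in> carrier End" "x \<in> carrier M"
  shows "(\<ominus>\<^bsub>End\<^esub> f) x = \<ominus>\<^bsub>M\<^esub> f x"
proof -
  have "(\<ominus>\<^bsub>End\<^esub> f \<oplus>\<^bsub>End\<^esub> f) x = \<zero>\<^bsub>M\<^esub>"
    using assms by (simp only: End.l_neg endo_zero_apply)
  then show ?thesis
    using assms M.minus_equality[of "(\<ominus>\<^bsub>End\<^esub> f) x" "f x"] by simp
qed

lemma endo_minus_apply [simp]:
  assumes "f \<in> carrier End" "g \<in> carrier End" "x \<in> carrier M"
  shows "(f \<ominus>\<^bsub>End\<^esub> g) x = f x \<ominus>\<^bsub>M\<^esub> g x"
  using assms by (simp add: a_minus_def)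

section \<open>Kernels, images and preimages\<close>

lemma submodule_kernel:
  assumes "f \<in> carrier End"
  shows "submodule (a_kernel M M f) R M"
  using assms by (intro submoduleI) (auto simp: a_kernel_def' endo_add endo_smult)

lemma submodule_image:
  assumes f: "f \<in> carrier End" and N: "submodule N R M"
  shows "submodule (f ` N) R M"
proof (rule submoduleI)
  note sub = subsetD[OF submodule_subset[OF N]]
  show "f ` N \<subseteq> carrier M"
    using f sub by auto
  show "\<zero>\<^bsub>M\<^esub> \<in> f ` N"
    using f submodule_zero[OF N] by (metis endo_zero imageI)
  show "x \<oplus>\<^bsub>M\<^esub> y \<in> f ` N" if "x \<in> f ` N" "y \<in> f ` N" for x y
    using that f sub by (auto simp: endo_add[symmetric] submodule_add[OF N])
  show "a \<odot>\<^bsub>M\<^esub> x \<in> f ` N" if "a \<in> carrier R" "x \<in> f ` N" for a x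
    using that f sub by (auto simp: endo_smult[symmetric] submodule_smult[OF N])
qed

lemma submodule_vimage:
  assumes f: "f \<in> carrier End" and N: "submodule N R M"
  shows "submodule {x \<in> carrier M. f x \<in> N} R M"
  using f by (intro submoduleI)
    (auto simp: endo_add endo_smult submodule_zero[OF N] submodule_add[OF N] submodule_smult[OF N])

lemma endo_inj_on:
  assumes f: "f \<in> carrier End" and N: "submodule N R M"
    and ker: "a_kernel M M f \<inter> N = {\<zero>\<^bsub>M\<^esub>}"
  shows "inj_on f N"
proof (rule inj_onI)
  fix x y assume xy: "x \<in> N" "y \<in> N" "f x = f y"
  then have c: "x \<in> carrier M" "y \<in> carrier M"
    using submodule_subset[OF N] by auto
  then have "f (x \<ominus>\<^bsub>M\<^esub> y) = \<zero>\<^bsub>M\<^esub>"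
    using f xy(3) by (simp add: endo_minus)
  moreover have "x \<ominus>\<^bsub>M\<^esub> y \<in> N"
    using xy unfolding a_minus_def by (intro submodule_add[OF N] submodule_minus[OF N])
  ultimately have "x \<ominus>\<^bsub>M\<^esub> y \<in> a_kernel M M f \<inter> N"
    using c by (simp add: a_kernel_def')
  then show "x = y"
    unfolding ker using c by simp
qed

section \<open>Idempotent endomorphisms and direct summands\<close>

lemma mem_set_add: "x \<in> A <+>\<^bsub>M\<^esub> B \<longleftrightarrow> (\<exists>a\<in>A. \<exists>b\<in>B. x = a \<oplus>\<^bsub>M\<^esub> b)"
  unfolding set_add_def' by blast

lemma idempotent_apply:
  assumes "e \<otimes>\<^bsub>End\<^esub> e = e" "x \<in> carrier M"
  shows "e (e x) = e x"
  using assms by (metis endo_mult_apply)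

text \<open>\<open>x = e x + (x - e x)\<close> splits \<open>M\<close> into image and kernel of
  \<open>e\<close>. Either of the two can then serve as the summand, with the other as
  complement.\<close>

lemma idempotent_kernel_image:
  assumes e: "e \<in> carrier End" "e \<otimes>\<^bsub>End\<^esub> e = e"
  shows "e ` carrier M \<inter> a_kernel M M e = {\<zero>\<^bsub>M\<^esub>}"
    and "x \<in> carrier M \<Longrightarrow> x \<ominus>\<^bsub>M\<^esub> e x \<in> a_kernel M M e"
proof -
  show "e ` carrier M \<inter> a_kernel M M e = {\<zero>\<^bsub>M\<^esub>}"
    using e endo_zero[OF e(1)] M.zero_closed
    by (auto simp: a_kernel_def' idempotent_apply intro: image_eqI[of _ _ "\<zero>\<^bsub>M\<^esub>"])
  show "x \<in> carrier M \<Longrightarrow> x \<ominus>\<^bsub>M\<^esub> e x \<in> a_kernel M M e"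
    using e by (simp add: a_kernel_def' endo_minus idempotent_apply)
qed

lemma direct_summand_idempotent_image:
  assumes e: "e \<in> carrier End" "e \<otimes>\<^bsub>End\<^esub> e = e"
  shows "direct_summand R M (e ` carrier M)"
  unfolding direct_summand_def
proof (intro conjI exI)
  have "x = e x \<oplus>\<^bsub>M\<^esub> (x \<ominus>\<^bsub>M\<^esub> e x)" if "x \<in> carrier M" for x
    using that e(1) by (simp add: a_minus_def M.a_ac M.r_neg)
  then have "carrier M \<subseteq> e ` carrier M <+>\<^bsub>M\<^esub> a_kernel M M e"
    unfolding subset_iff mem_set_add using idempotent_kernel_image(2)[OF e] by blast
  moreover have "e ` carrier M <+>\<^bsub>M\<^esub> a_kernel M M e \<subseteq> carrier M"
    using e(1) by (auto simp: mem_set_add a_kernel_def')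
  ultimately show "e ` carrier M <+>\<^bsub>M\<^esub> a_kernel M M e = carrier M"
    by (rule equalityI[rotated])
qed (use e in \<open>simp_all add: submodule_image submodule_carrier submodule_kernel idempotent_kernel_image\<close>)

lemma direct_summand_idempotent_kernel:
  assumes e: "e \<in> carrier End" "e \<otimes>\<^bsub>End\<^esub> e = e"
  shows "direct_summand R M (a_kernel M M e)"
  unfolding direct_summand_def
proof (intro conjI exI)
  have "x = (x \<ominus>\<^bsub>M\<^esub> e x) \<oplus>\<^bsub>M\<^esub> e x" if "x \<in> carrier M" for x
    using that e(1) by (simp add: a_minus_def M.a_assoc M.l_neg)
  then have "carrier M \<subseteq> a_kernel M M e <+>\<^bsub>M\<^esub> e ` carrier M"
    unfolding subset_iff mem_set_add using idempotent_kernel_image(2)[OF e] by blast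
  moreover have "a_kernel M M e <+>\<^bsub>M\<^esub> e ` carrier M \<subseteq> carrier M"
    using e(1) by (auto simp: mem_set_add a_kernel_def')
  ultimately show "a_kernel M M e <+>\<^bsub>M\<^esub> e ` carrier M = carrier M"
    by (rule equalityI[rotated])
  show "a_kernel M M e \<inter> e ` carrier M = {\<zero>\<^bsub>M\<^esub>}"
    using idempotent_kernel_image(1)[OF e] by blast
qed (use e in \<open>simp_all add: submodule_image submodule_carrier submodule_kernel\<close>)

text \<open>Relative to a complement \<open>K\<close>, each element has a unique component in
  \<open>D\<close>. A choice function for these components is linear because of uniqueness, and it
  is the projection along \<open>K\<close>.\<close>

lemma direct_summand_projection:
  assumes "direct_summand R M D"
  obtains e where "e \<in> carrier End" "e \<otimes>\<^bsub>End\<^esub> e = e" "e ` carrier M = D" "\<And>x. x \<in> D \<Longrightarrow> e x = x"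
proof -
  obtain K where D: "submodule D R M" and K: "submodule K R M"
    and int: "D \<inter> K = {\<zero>\<^bsub>M\<^esub>}" and sum: "D <+>\<^bsub>M\<^esub> K = carrier M"
    using assms by (auto simp: direct_summand_def)
  note Dc = subsetD[OF submodule_subset[OF D]] and Kc = subsetD[OF submodule_subset[OF K]]
  \<comment> \<open>The difference \<open>d - d' = k' - k\<close> lies in both \<open>D\<close> and
    \<open>K\<close>.\<close>
  have uniq: "d = d'" if d: "d \<in> D" "d' \<in> D" and k: "k \<in> K" "k' \<in> K"
    and eq: "d \<oplus>\<^bsub>M\<^esub> k = d' \<oplus>\<^bsub>M\<^esub> k'" for d d' k k'
  proof -
    have "d \<ominus>\<^bsub>M\<^esub> d' = (d \<oplus>\<^bsub>M\<^esub> k) \<ominus>\<^bsub>M\<^esub> (d' \<oplus>\<^bsub>M\<^esub> k)"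
      using d k Dc Kc by (simp add: add_minus_add_cancel)
    also have "\<dots> = k' \<ominus>\<^bsub>M\<^esub> k"
      unfolding eq using d k Dc Kc by (simp add: add_minus_add_cancel M.a_comm[of d'])
    finally have "d \<ominus>\<^bsub>M\<^esub> d' = k' \<ominus>\<^bsub>M\<^esub> k" .
    moreover have "d \<ominus>\<^bsub>M\<^esub> d' \<in> D" "k' \<ominus>\<^bsub>M\<^esub> k \<in> K"
      using d k unfolding a_minus_def
      by (simp_all add: submodule_add[OF D] submodule_add[OF K] submodule_minus[OF D]
          submodule_minus[OF K])
    ultimately have "d \<ominus>\<^bsub>M\<^esub> d' \<in> D \<inter> K"
      by simp
    then show ?thesis
      using int d Dc by simp
  qed
  have "\<forall>x\<in>carrier M. \<exists>d. d \<in> D \<and> (\<exists>k\<in>K. x = d \<oplus>\<^bsub>M\<^esub> k)"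
    using equalityD2[OF sum] unfolding subset_iff mem_set_add by blast
  from bchoice[OF this] obtain p
    where p: "\<And>x. x \<in> carrier M \<Longrightarrow> p x \<in> D"
      and p_K: "\<And>x. x \<in> carrier M \<Longrightarrow> \<exists>k\<in>K. x = p x \<oplus>\<^bsub>M\<^esub> k"
    by blast
  \<comment> \<open>Any decomposition computes \<open>p\<close>. Linearity follows below by adding
    and scaling decompositions.\<close>
  have p_eq: "p (d \<oplus>\<^bsub>M\<^esub> k) = d" if "d \<in> D" "k \<in> K" for d k
  proof -
    have c: "d \<oplus>\<^bsub>M\<^esub> k \<in> carrier M"
      using that Dc Kc by simp
    obtain k' where "k' \<in> K" "d \<oplus>\<^bsub>M\<^esub> k = p (d \<oplus>\<^bsub>M\<^esub> k) \<oplus>\<^bsub>M\<^esub> k'"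
      using p_K[OF c] by blast
    then show ?thesis
      using uniq[OF p[OF c] that(1)] that(2) by simp
  qed
  have p_id: "p x = x" if "x \<in> D" for x
    using p_eq[OF that submodule_zero[OF K]] Dc[OF that] by simp
  define e where "e = (\<lambda>x\<in>carrier M. p x)"
  have e: "e \<in> carrier End"
    unfolding e_def
  proof (rule endo_restrictI)
    fix x assume x: "x \<in> carrier M"
    then show "p x \<in> carrier M"
      using p Dc by blast
    obtain k where k: "k \<in> K" "x = p x \<oplus>\<^bsub>M\<^esub> k"
      using p_K x by blast
    show "p (a \<odot>\<^bsub>M\<^esub> x) = a \<odot>\<^bsub>M\<^esub> p x" if a: "a \<in> carrier R" for a
    proof -
      have "a \<odot>\<^bsub>M\<^esub> x = a \<odot>\<^bsub>M\<^esub> p x \<oplus>\<^bsub>M\<^esub> a \<odot>\<^bsub>M\<^esub> k"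
        using arg_cong[OF k(2), of "\<lambda>z. a \<odot>\<^bsub>M\<^esub> z"] smult_r_distr[OF a Dc[OF p[OF x]] Kc[OF k(1)]]
        by simp
      then show ?thesis
        using p_eq[OF submodule_smult[OF D a p[OF x]] submodule_smult[OF K a k(1)]] by simp
    qed
    show "p (x \<oplus>\<^bsub>M\<^esub> y) = p x \<oplus>\<^bsub>M\<^esub> p y" if y: "y \<in> carrier M" for y
    proof -
      obtain l where l: "l \<in> K" "y = p y \<oplus>\<^bsub>M\<^esub> l"
        using p_K y by blast
      have "p x \<in> carrier M" "p y \<in> carrier M" "k \<in> carrier M" "l \<in> carrier M"
        using x y p Dc k(1) l(1) Kc by auto
      then have "(p x \<oplus>\<^bsub>M\<^esub> k) \<oplus>\<^bsub>M\<^esub> (p y \<oplus>\<^bsub>M\<^esub> l) = (p x \<oplus>\<^bsub>M\<^esub> p y) \<oplus>\<^bsub>M\<^esub> (k \<oplus>\<^bsub>M\<^esub> l)"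
        by (simp add: M.a_ac)
      then have "p ((p x \<oplus>\<^bsub>M\<^esub> k) \<oplus>\<^bsub>M\<^esub> (p y \<oplus>\<^bsub>M\<^esub> l)) = p x \<oplus>\<^bsub>M\<^esub> p y"
        using p_eq[OF submodule_add[OF D p[OF x] p[OF y]] submodule_add[OF K k(1) l(1)]] by simp
      then show ?thesis
        by (simp add: k(2)[symmetric] l(2)[symmetric])
    qed
  qed
  have e_id: "e x = x" if "x \<in> D" for x
    using that Dc by (simp add: e_def p_id)
  have e_D: "e x \<in> D" if "x \<in> carrier M" for x
    using that p by (simp add: e_def)
  show ?thesis
  proof (rule that)
    show "e \<otimes>\<^bsub>End\<^esub> e = e"
      by (rule endo_eqI) (use e e_id e_D in simp_all)
    show "e ` carrier M = D"
      using e_id e_D Dc by force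
  qed (use e e_id in auto)
qed

subsection \<open>Essential submodules, CS-Rickart and C2\<close>

lemma minus_zero [simp]:
  assumes "x \<in> carrier M"
  shows "x \<ominus>\<^bsub>M\<^esub> \<zero>\<^bsub>M\<^esub> = x"
  using assms M.minus_equality[of "\<zero>\<^bsub>M\<^esub>" "\<zero>\<^bsub>M\<^esub>"] by (simp add: a_minus_def)

lemma
  assumes "essential_submodule R M N K"
  shows essential_submodule_left: "submodule N R M"
    and essential_submodule_right: "submodule K R M"
    and essential_submodule_subset: "N \<subseteq> K"
    and essential_submodule_zero:
      "\<And>L. submodule L R M \<Longrightarrow> L \<subseteq> K \<Longrightarrow> N \<inter> L = {\<zero>\<^bsub>M\<^esub>} \<Longrightarrow> L = {\<zero>\<^bsub>M\<^esub>}"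
  using assms by (auto simp: essential_submodule_def)

lemma essential_submodule_mono:
  assumes ess: "essential_submodule R M N K" and N': "submodule N' R M" "N \<subseteq> N'" "N' \<subseteq> K"
  shows "essential_submodule R M N' K"
  unfolding essential_submodule_def
proof (intro conjI allI impI)
  fix L assume L: "submodule L R M \<and> L \<subseteq> K \<and> N' \<inter> L = {\<zero>\<^bsub>M\<^esub>}"
  then have "N \<inter> L = {\<zero>\<^bsub>M\<^esub>}"
    using N'(2) submodule_zero[OF essential_submodule_left[OF ess]] submodule_zero[of L] by blast
  then show "L = {\<zero>\<^bsub>M\<^esub>}"
    using L essential_submodule_zero[OF ess] by blast
qed (use N' essential_submodule_right[OF ess] in auto)

text \<open>Essentiality is used twice: \<open>N\<close> forces \<open>N' \<inter> L\<close> to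
  vanish, and then \<open>N'\<close> forces \<open>L\<close> to vanish.\<close>

lemma essential_submodule_Int:
  assumes N: "essential_submodule R M N K" and N': "essential_submodule R M N' K"
  shows "essential_submodule R M (N \<inter> N') K"
  unfolding essential_submodule_def
proof (intro conjI allI impI)
  note sub = essential_submodule_left[OF N] essential_submodule_left[OF N']
  show "submodule (N \<inter> N') R M"
    by (intro submodule_Int sub)
  fix L assume L: "submodule L R M \<and> L \<subseteq> K \<and> N \<inter> N' \<inter> L = {\<zero>\<^bsub>M\<^esub>}"
  then have "submodule (N' \<inter> L) R M" "N' \<inter> L \<subseteq> K" "N \<inter> (N' \<inter> L) = {\<zero>\<^bsub>M\<^esub>}"
    by (auto intro: submodule_Int sub)
  then have "N' \<inter> L = {\<zero>\<^bsub>M\<^esub>}"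
    by (rule essential_submodule_zero[OF N])
  then show "L = {\<zero>\<^bsub>M\<^esub>}"
    using L essential_submodule_zero[OF N'] by blast
qed (use essential_submodule_right[OF N] essential_submodule_subset[OF N] in auto)

text \<open>If \<open>L\<close> meets the preimage trivially, then the image of \<open>L\<close>
  under \<open>f\<close> meets \<open>N\<close> trivially and so is zero. Hence \<open>L\<close>
  lies in the kernel, which is part of the preimage, and \<open>L\<close> itself is zero.\<close>

lemma essential_submodule_vimage:
  assumes ess: "essential_submodule R M N K" and f: "f \<in> carrier End" "f ` carrier M \<subseteq> K"
  shows "essential_submodule R M {x \<in> carrier M. f x \<in> N} (carrier M)"
  unfolding essential_submodule_def
proof (intro conjI allI impI)
  note N = essential_submodule_left[OF ess]
  show "submodule {x \<in> carrier M. f x \<in> N} R M"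
    by (rule submodule_vimage[OF f(1) N])
  fix L assume L: "submodule L R M \<and> L \<subseteq> carrier M \<and> {x \<in> carrier M. f x \<in> N} \<inter> L = {\<zero>\<^bsub>M\<^esub>}"
  have "N \<inter> f ` L \<subseteq> {\<zero>\<^bsub>M\<^esub>}"
  proof
    fix y assume "y \<in> N \<inter> f ` L"
    then obtain x where "x \<in> L" "y = f x" "f x \<in> N"
      by auto
    then have "x \<in> {x \<in> carrier M. f x \<in> N} \<inter> L" "y = f x"
      using L by auto
    then show "y \<in> {\<zero>\<^bsub>M\<^esub>}"
      using L f(1) by simp
  qed
  moreover have fL: "submodule (f ` L) R M" "f ` L \<subseteq> K"
    using L f by (auto intro: submodule_image)
  ultimately have "N \<inter> f ` L = {\<zero>\<^bsub>M\<^esub>}"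
    using submodule_zero[OF N] submodule_zero[OF fL(1)] by blast
  then have "f ` L = {\<zero>\<^bsub>M\<^esub>}"
    by (rule essential_submodule_zero[OF ess fL])
  then have "f x = \<zero>\<^bsub>M\<^esub>" if "x \<in> L" for x
    using imageI[OF that, of f] by simp
  then have "L \<subseteq> {x \<in> carrier M. f x \<in> N}"
    using L submodule_zero[OF N] by auto
  then show "L = {\<zero>\<^bsub>M\<^esub>}"
    using conjunct2[OF conjunct2[OF L]] by (simp only: Int_absorb1)
qed (auto intro: submodule_carrier)

lemma essential_submodule_carrier_restrict:
  assumes ess: "essential_submodule R M N (carrier M)" and K: "submodule K R M"
  shows "essential_submodule R M (N \<inter> K) K"
  unfolding essential_submodule_def
proof (intro conjI allI impI)
  show "submodule (N \<inter> K) R M"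
    by (intro submodule_Int K essential_submodule_left[OF ess])
  fix L assume L: "submodule L R M \<and> L \<subseteq> K \<and> N \<inter> K \<inter> L = {\<zero>\<^bsub>M\<^esub>}"
  then have "L \<subseteq> carrier M" "N \<inter> L = {\<zero>\<^bsub>M\<^esub>}"
    using submodule_subset[OF K] by blast+
  then show "L = {\<zero>\<^bsub>M\<^esub>}"
    using L essential_submodule_zero[OF ess] by blast
qed (use K in auto)

text \<open>The part of \<open>K\<close> in the kernel of the projection \<open>e\<close> onto
  \<open>D\<close> meets \<open>D\<close> trivially, so it is zero; it contains
  \<open>x - e x\<close> for every \<open>x\<close> in \<open>K\<close>.\<close>

lemma direct_summand_essential_eq:
  assumes D: "direct_summand R M D" and ess: "essential_submodule R M D K"
  shows "D = K"
proof -
  obtain e where e: "e \<in> carrier End" "e \<otimes>\<^bsub>End\<^esub> e = e" "e ` carrier M = D" "\<And>x. x \<in> D \<Longrightarrow> e x = x"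
    using direct_summand_projection[OF D] by blast
  note K = essential_submodule_right[OF ess] and sub = essential_submodule_subset[OF ess]
  have int: "D \<inter> (a_kernel M M e \<inter> K) = {\<zero>\<^bsub>M\<^esub>}"
    using idempotent_kernel_image(1)[OF e(1,2)] submodule_zero[OF K] unfolding e(3) by blast
  have ker: "a_kernel M M e \<inter> K = {\<zero>\<^bsub>M\<^esub>}"
    by (rule essential_submodule_zero[OF ess submodule_Int[OF submodule_kernel[OF e(1)] K] _ int])
      simp
  have "x \<in> D" if x: "x \<in> K" for x
  proof -
    have xc: "x \<in> carrier M"
      using x submodule_subset[OF K] by blast
    then have ex: "e x \<in> D"
      using e(3) by blast
    then have "x \<ominus>\<^bsub>M\<^esub> e x \<in> K"
      unfolding a_minus_def
      by (intro submodule_add[OF K x] submodule_minus[OF K] subsetD[OF sub])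
    then have "x \<ominus>\<^bsub>M\<^esub> e x \<in> a_kernel M M e \<inter> K"
      using idempotent_kernel_image(2)[OF e(1,2) xc] by blast
    then show ?thesis
      unfolding ker using xc ex e(1) by simp
  qed
  then show ?thesis
    using sub by blast
qed

section \<open>The ideal \<open>Delta\<close>\<close>

lemma Delta_iff:
  "f \<in> Delta R M \<longleftrightarrow> f \<in> carrier End \<and> essential_submodule R M (a_kernel M M f) (carrier M)"
  by (simp add: Delta_def)

text \<open>Anything between an essential submodule and \<open>M\<close> is essential, so vanishing
  on some essential submodule suffices.\<close>

lemma DeltaI:
  assumes f: "f \<in> carrier End" and ess: "essential_submodule R M N (carrier M)"
    and zero: "\<And>x. x \<in> N \<Longrightarrow> x \<in> carrier M \<Longrightarrow> f x = \<zero>\<^bsub>M\<^esub>"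
  shows "f \<in> Delta R M"
  unfolding Delta_iff
proof (intro conjI f essential_submodule_mono[OF ess] submodule_kernel)
  show "N \<subseteq> a_kernel M M f"
    using essential_submodule_subset[OF ess] zero by (auto simp: a_kernel_def')
  show "a_kernel M M f \<subseteq> carrier M"
    by (auto simp: a_kernel_def')
qed

text \<open>The kernel of \<open>f + g\<close> contains the intersection of both kernels, that of
  \<open>g f\<close> contains \<open>Ker f\<close>, and that of \<open>f g\<close> contains the
  preimage of \<open>Ker f\<close> under \<open>g\<close>. Each of these is essential.\<close>

lemma ideal_Delta: "ideal (Delta R M) End"
proof -
  note ess = conjunct2[OF Delta_iff[THEN iffD1]]
  have sub: "Delta R M \<subseteq> carrier End"
    by (auto simp: Delta_iff)
  have zero: "\<zero>\<^bsub>End\<^esub> \<in> Delta R M"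
  proof (rule DeltaI)
    show "essential_submodule R M (carrier M) (carrier M)"
      by (auto simp: essential_submodule_def submodule_carrier dest: submodule_subset)
  qed auto
  have add: "f \<oplus>\<^bsub>End\<^esub> g \<in> Delta R M" if "f \<in> Delta R M" "g \<in> Delta R M" for f g
    by (rule DeltaI[OF _ essential_submodule_Int[OF ess[OF that(1)] ess[OF that(2)]]])
      (use that sub in \<open>auto simp: a_kernel_def'\<close>)
  have l: "g \<otimes>\<^bsub>End\<^esub> f \<in> Delta R M" if "f \<in> Delta R M" "g \<in> carrier End" for f g
    by (rule DeltaI[OF _ ess[OF that(1)]]) (use that sub in \<open>auto simp: a_kernel_def'\<close>)
  have r: "f \<otimes>\<^bsub>End\<^esub> g \<in> Delta R M" if fg: "f \<in> Delta R M" "g \<in> carrier End" for f g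
  proof (rule DeltaI)
    show "essential_submodule R M {x \<in> carrier M. g x \<in> a_kernel M M f} (carrier M)"
      using fg by (intro essential_submodule_vimage[OF ess[OF fg(1)]]) auto
  qed (use fg sub in \<open>auto simp: a_kernel_def'\<close>)
  have "\<ominus>\<^bsub>End\<^esub> f \<in> Delta R M" if "f \<in> Delta R M" for f
    using l[OF that, of "\<ominus>\<^bsub>End\<^esub> \<one>\<^bsub>End\<^esub>"] subsetD[OF sub that] by (simp add: End.l_minus)
  then have "subgroup (Delta R M) (add_monoid End)"
    using sub zero add by (intro End.add.subgroupI) (auto simp: a_inv_def)
  then show ?thesis
    by (rule idealI[OF ring_End]) (use l r in auto)
qed

section \<open>Homomorphisms between submodules and the condition C2\<close>

lemma rmod_hom_inv:
  assumes f: "f \<in> rmod_hom R (M\<lparr>carrier := A\<rparr>) (M\<lparr>carrier := B\<rparr>)" and bij: "bij_betw f A B"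
    and A: "submodule A R M"
  shows "(\<lambda>y\<in>B. inv_into A f y) \<in> rmod_hom R (M\<lparr>carrier := B\<rparr>) (M\<lparr>carrier := A\<rparr>)"
proof -
  let ?g = "inv_into A f"
  have f': "\<And>x y. x \<in> A \<Longrightarrow> y \<in> A \<Longrightarrow> f (x \<oplus>\<^bsub>M\<^esub> y) = f x \<oplus>\<^bsub>M\<^esub> f y"
    "\<And>a x. a \<in> carrier R \<Longrightarrow> x \<in> A \<Longrightarrow> f (a \<odot>\<^bsub>M\<^esub> x) = a \<odot>\<^bsub>M\<^esub> f x"
    using f by (auto simp: rmod_hom_restricted)
  have im: "f ` A = B" and inj: "inj_on f A"
    using bij by (auto simp: bij_betw_def)
  have g: "?g (f x) = x" if "x \<in> A" for x
    using inj that by simp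
  have gB: "?g y \<in> A" "f (?g y) = y" if "y \<in> B" for y
    using that im by (auto intro: inv_into_into f_inv_into_f)
  \<comment> \<open>Closure of \<open>B\<close> under addition is obtained along the way,
    \<open>B\<close> being the image of the submodule \<open>A\<close>.\<close>
  have add: "?g (y \<oplus>\<^bsub>M\<^esub> z) = ?g y \<oplus>\<^bsub>M\<^esub> ?g z" "y \<oplus>\<^bsub>M\<^esub> z \<in> B" if "y \<in> B" "z \<in> B" for y z
  proof -
    have A': "?g y \<oplus>\<^bsub>M\<^esub> ?g z \<in> A"
      using that gB(1) by (intro submodule_add[OF A])
    have eq: "f (?g y \<oplus>\<^bsub>M\<^esub> ?g z) = y \<oplus>\<^bsub>M\<^esub> z"
      using that gB f'(1) by simp
    show "?g (y \<oplus>\<^bsub>M\<^esub> z) = ?g y \<oplus>\<^bsub>M\<^esub> ?g z"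
      using g[OF A'] unfolding eq .
    show "y \<oplus>\<^bsub>M\<^esub> z \<in> B"
      using imageI[OF A', of f] unfolding eq im .
  qed
  have smult: "?g (a \<odot>\<^bsub>M\<^esub> y) = a \<odot>\<^bsub>M\<^esub> ?g y" "a \<odot>\<^bsub>M\<^esub> y \<in> B"
    if "a \<in> carrier R" "y \<in> B" for a y
  proof -
    have A': "a \<odot>\<^bsub>M\<^esub> ?g y \<in> A"
      using that gB(1) by (intro submodule_smult[OF A])
    have eq: "f (a \<odot>\<^bsub>M\<^esub> ?g y) = a \<odot>\<^bsub>M\<^esub> y"
      using that gB f'(2) by simp
    show "?g (a \<odot>\<^bsub>M\<^esub> y) = a \<odot>\<^bsub>M\<^esub> ?g y"
      using g[OF A'] unfolding eq .
    show "a \<odot>\<^bsub>M\<^esub> y \<in> B"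
      using imageI[OF A', of f] unfolding eq im .
  qed
  show ?thesis
    unfolding rmod_hom_restricted by (simp add: gB add smult)
qed

text \<open>Used with \<open>q\<close> a projection onto a summand \<open>B\<close>: precomposing
  with it extends a homomorphism on \<open>B\<close> to all of \<open>M\<close>.\<close>

lemma endo_extend_projection:
  assumes h: "h \<in> rmod_hom R (M\<lparr>carrier := B\<rparr>) (M\<lparr>carrier := A\<rparr>)" and A: "A \<subseteq> carrier M"
    and q: "q \<in> carrier End" "q ` carrier M \<subseteq> B"
  shows "(\<lambda>x\<in>carrier M. h (q x)) \<in> carrier End"
proof (rule endo_restrictI)
  have h': "\<And>x. x \<in> B \<Longrightarrow> h x \<in> A"
    "\<And>x y. x \<in> B \<Longrightarrow> y \<in> B \<Longrightarrow> h (x \<oplus>\<^bsub>M\<^esub> y) = h x \<oplus>\<^bsub>M\<^esub> h y"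
    "\<And>a x. a \<in> carrier R \<Longrightarrow> x \<in> B \<Longrightarrow> h (a \<odot>\<^bsub>M\<^esub> x) = a \<odot>\<^bsub>M\<^esub> h x"
    using h by (auto simp: rmod_hom_restricted)
  have qB: "q x \<in> B" if "x \<in> carrier M" for x
    using q(2) that by blast
  show "h (q x) \<in> carrier M" if "x \<in> carrier M" for x
    using h'(1)[OF qB[OF that]] A by blast
  show "h (q (x \<oplus>\<^bsub>M\<^esub> y)) = h (q x) \<oplus>\<^bsub>M\<^esub> h (q y)" if "x \<in> carrier M" "y \<in> carrier M" for x y
    using that q(1) by (simp add: endo_add h'(2) qB)
  show "h (q (a \<odot>\<^bsub>M\<^esub> x)) = a \<odot>\<^bsub>M\<^esub> h (q x)" if "a \<in> carrier R" "x \<in> carrier M" for a x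
    using that q(1) by (simp add: endo_smult h'(3) qB)
qed

lemma endo_restrict_hom:
  assumes f: "f \<in> carrier End" and A: "submodule A R M"
  shows "(\<lambda>x\<in>A. f x) \<in> rmod_hom R (M\<lparr>carrier := A\<rparr>) (M\<lparr>carrier := f ` A\<rparr>)"
  unfolding rmod_hom_restricted using f subsetD[OF submodule_subset[OF A]]
  by (auto simp: endo_add endo_smult submodule_add[OF A] submodule_smult[OF A])

text \<open>The inverse \<open>h\<close> of \<open>f\<close> on \<open>D\<close> is an isomorphism
  onto \<open>D\<close> from the image of \<open>D\<close>, the direction in which C2 asks for
  one.\<close>

lemma C2_module_image:
  assumes C2: "C2_module R M" and D: "direct_summand R M D"
    and f: "f \<in> carrier End" and inj: "inj_on f D"
  shows "direct_summand R M (f ` D)"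
    and "\<exists>g\<in>carrier End. \<forall>x\<in>D. g (f x) = x"
proof -
  have subD: "submodule D R M"
    using D by (simp add: direct_summand_def)
  define h where "h = (\<lambda>y\<in>f ` D. inv_into D (\<lambda>x\<in>D. f x) y)"
  have bij: "bij_betw (\<lambda>x\<in>D. f x) D (f ` D)"
    using inj by (auto simp: bij_betw_def inj_on_def)
  have h: "h \<in> rmod_hom R (M\<lparr>carrier := f ` D\<rparr>) (M\<lparr>carrier := D\<rparr>)"
    unfolding h_def by (rule rmod_hom_inv[OF endo_restrict_hom[OF f subD] bij subD])
  have h_f: "h (f x) = x" if "x \<in> D" for x
    using bij that inv_into_f_f[of "\<lambda>x\<in>D. f x" D x] by (simp add: h_def bij_betw_def)
  have "bij_betw h (f ` D) D"
    by (rule bij_betw_byWitness[where f' = f]) (auto simp: h_f)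
  then have "rmod_iso R (M\<lparr>carrier := f ` D\<rparr>) (M\<lparr>carrier := D\<rparr>)"
    using h unfolding rmod_iso_def by auto
  then show summand: "direct_summand R M (f ` D)"
    using C2 D submodule_image[OF f subD] unfolding C2_module_def by blast
  \<comment> \<open>Now that the image of \<open>D\<close> is a summand, the projection
    \<open>q\<close> onto it extends \<open>h\<close> to an endomorphism.\<close>
  obtain q where q: "q \<in> carrier End" "q ` carrier M = f ` D" "\<And>x. x \<in> f ` D \<Longrightarrow> q x = x"
    using direct_summand_projection[OF summand] by metis
  have "(\<lambda>x\<in>carrier M. h (q x)) \<in> carrier End"
    by (rule endo_extend_projection[OF h submodule_subset[OF subD] q(1)]) (simp add: q(2))
  moreover have "\<forall>x\<in>D. (\<lambda>x\<in>carrier M. h (q x)) (f x) = x"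
    using subsetD[OF submodule_subset[OF subD]] f by (simp add: q(3) h_f)
  ultimately show "\<exists>g\<in>carrier End. \<forall>x\<in>D. g (f x) = x"
    by blast
qed

section \<open>Units and idempotent multiples from CS-Rickart and C2\<close>

lemma direct_summand_carrier: "direct_summand R M (carrier M)"
proof -
  have "\<one>\<^bsub>End\<^esub> ` carrier M = carrier M"
    by simp
  then show ?thesis
    using direct_summand_idempotent_image[of "\<one>\<^bsub>End\<^esub>"] by simp
qed

text \<open>Where \<open>d\<close> vanishes, \<open>1 - d\<close> is the identity. Hence its kernel
  meets the essential \<open>Ker d\<close> only in zero, and its image contains
  \<open>Ker d\<close>. By C2 this image is a summand; being essential too, it is all of
  \<open>M\<close>.\<close>

lemma C2_module_one_minus_Delta_unit:
  assumes C2: "C2_module R M" and d: "d \<in> Delta R M"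
  shows "\<one>\<^bsub>End\<^esub> \<ominus>\<^bsub>End\<^esub> d \<in> Units End"
proof -
  let ?f = "\<one>\<^bsub>End\<^esub> \<ominus>\<^bsub>End\<^esub> d"
  have dc: "d \<in> carrier End" and ess: "essential_submodule R M (a_kernel M M d) (carrier M)"
    using d by (auto simp: Delta_iff)
  have f: "?f \<in> carrier End"
    using dc by simp
  have ker: "a_kernel M M d \<inter> a_kernel M M ?f = {\<zero>\<^bsub>M\<^esub>}"
    using dc by (auto simp: a_kernel_def')
  have "a_kernel M M ?f = {\<zero>\<^bsub>M\<^esub>}"
    by (rule essential_submodule_zero[OF ess submodule_kernel[OF f] _ ker])
      (auto simp: a_kernel_def')
  then have inj: "inj_on ?f (carrier M)"
    by (intro endo_inj_on f submodule_carrier) auto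
  note C2' = C2_module_image[OF C2 direct_summand_carrier f inj]
  have "a_kernel M M d \<subseteq> ?f ` carrier M"
  proof
    fix x assume "x \<in> a_kernel M M d"
    then have "x \<in> carrier M" "?f x = x"
      using dc by (auto simp: a_kernel_def')
    then show "x \<in> ?f ` carrier M"
      by (metis imageI)
  qed
  then have "essential_submodule R M (?f ` carrier M) (carrier M)"
    using f by (intro essential_submodule_mono[OF ess] submodule_image submodule_carrier) auto
  then have surj: "?f ` carrier M = carrier M"
    by (rule direct_summand_essential_eq[OF C2'(1)])
  obtain g where g: "g \<in> carrier End" "\<And>x. x \<in> carrier M \<Longrightarrow> g (?f x) = x"
    using C2'(2) by blast
  have gf: "g \<otimes>\<^bsub>End\<^esub> ?f = \<one>\<^bsub>End\<^esub>"
    by (rule endo_eqI) (use g f in \<open>simp_all del: endo_minus_apply\<close>)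
  have fg: "?f \<otimes>\<^bsub>End\<^esub> g = \<one>\<^bsub>End\<^esub>"
  proof (rule endo_eqI)
    fix y assume y: "y \<in> carrier M"
    then obtain x where x: "x \<in> carrier M" "y = ?f x"
      using surj by blast
    have "(?f \<otimes>\<^bsub>End\<^esub> g) y = ?f (g y)"
      using y by (rule endo_mult_apply)
    also have "\<dots> = y"
      unfolding x(2) g(2)[OF x(1)] ..
    finally show "(?f \<otimes>\<^bsub>End\<^esub> g) y = \<one>\<^bsub>End\<^esub> y"
      using y by simp
  qed (use f g in auto)
  show ?thesis
    unfolding Units_def using f g(1) gf fg by blast
qed

lemma CS_Rickart_C2_idempotent_multiple:
  assumes CS: "CS_Rickart R M" and C2: "C2_module R M" and f: "f \<in> carrier End"
  shows "\<exists>b\<in>carrier End. b \<otimes>\<^bsub>End\<^esub> f \<otimes>\<^bsub>End\<^esub> (b \<otimes>\<^bsub>End\<^esub> f) = b \<otimes>\<^bsub>End\<^esub> f \<and>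
    f \<ominus>\<^bsub>End\<^esub> f \<otimes>\<^bsub>End\<^esub> (b \<otimes>\<^bsub>End\<^esub> f) \<in> Delta R M"
proof -
  obtain D where D: "direct_summand R M D" and ess: "essential_submodule R M (a_kernel M M f) D"
    using CS f unfolding CS_Rickart_def by blast
  obtain p where p: "p \<in> carrier End" "p \<otimes>\<^bsub>End\<^esub> p = p" "p ` carrier M = D" "\<And>x. x \<in> D \<Longrightarrow> p x = x"
    using direct_summand_projection[OF D] by blast
  \<comment> \<open>The complementary idempotent projects along \<open>D\<close> onto
    \<open>Ker p\<close>, the \<open>E\<close> of the overview.\<close>
  define e where "e = \<one>\<^bsub>End\<^esub> \<ominus>\<^bsub>End\<^esub> p"
  have e: "e \<in> carrier End"
    using p(1) by (simp add: e_def)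
  have e_apply: "e x = x \<ominus>\<^bsub>M\<^esub> p x" if "x \<in> carrier M" for x
    using p(1) that by (simp add: e_def)
  have e_ker: "e x \<in> a_kernel M M p" if "x \<in> carrier M" for x
    using idempotent_kernel_image(2)[OF p(1,2) that] by (simp add: e_apply that)
  have e_id: "e x = x" if "x \<in> a_kernel M M p" for x
    using that by (simp add: e_apply a_kernel_def')
  have kerc: "a_kernel M M p \<subseteq> carrier M"
    by (auto simp: a_kernel_def')
  have "a_kernel M M f \<inter> a_kernel M M p = {\<zero>\<^bsub>M\<^esub>}"
    using idempotent_kernel_image(1)[OF p(1,2)] essential_submodule_subset[OF ess]
      submodule_zero[OF submodule_kernel[OF f]] unfolding p(3) by blast
  then have "inj_on f (a_kernel M M p)"
    by (rule endo_inj_on[OF f submodule_kernel[OF p(1)]])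
  then obtain g where g: "g \<in> carrier End" "\<And>x. x \<in> a_kernel M M p \<Longrightarrow> g (f x) = x"
    using C2_module_image(2)[OF C2 direct_summand_idempotent_kernel[OF p(1,2)] f] by blast
  \<comment> \<open>\<open>g\<close> is controlled only on the image of \<open>Ker p\<close> under
    \<open>f\<close>. Following it by \<open>e\<close> forces all values of \<open>b\<close> into
    \<open>Ker p\<close>, where \<open>b f\<close> is the identity; so \<open>b f\<close> is
    idempotent.\<close>
  define b where "b = e \<otimes>\<^bsub>End\<^esub> g"
  have b: "b \<in> carrier End"
    using e g(1) by (simp add: b_def)
  have bf: "b (f x) = e (g (f x))" if "x \<in> carrier M" for x
    using that f by (simp add: b_def)
  have bf_ker: "b (f x) \<in> a_kernel M M p" if "x \<in> carrier M" for x
    using that f g(1) by (simp add: bf e_ker)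
  have bf_id: "b (f x) = x" if "x \<in> a_kernel M M p" for x
    using that kerc by (auto simp: bf g(2) e_id)
  have idem: "b \<otimes>\<^bsub>End\<^esub> f \<otimes>\<^bsub>End\<^esub> (b \<otimes>\<^bsub>End\<^esub> f) = b \<otimes>\<^bsub>End\<^esub> f"
    by (rule endo_eqI) (use b f in \<open>simp_all add: bf_id bf_ker\<close>)
  have "f \<ominus>\<^bsub>End\<^esub> f \<otimes>\<^bsub>End\<^esub> (b \<otimes>\<^bsub>End\<^esub> f) \<in> Delta R M"
  proof (rule DeltaI)
    \<comment> \<open>The elements whose \<open>D\<close>-component is in \<open>Ker f\<close>: a
      preimage under \<open>p\<close> of a submodule essential in \<open>D\<close>.\<close>
    show "essential_submodule R M {x \<in> carrier M. p x \<in> a_kernel M M f} (carrier M)"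
      using p by (intro essential_submodule_vimage[OF ess]) auto
    fix x assume "x \<in> {x \<in> carrier M. p x \<in> a_kernel M M f}"
    then have x: "x \<in> carrier M" "f (p x) = \<zero>\<^bsub>M\<^esub>"
      by (auto simp: a_kernel_def')
    \<comment> \<open>\<open>x\<close> and \<open>e x\<close> differ by \<open>p x\<close>, which
      \<open>f\<close> kills.\<close>
    have "f (e x) = f x"
      using x f p(1) by (simp add: e_apply endo_minus)
    moreover have "b (f (e x)) = e x"
      by (rule bf_id[OF e_ker[OF x(1)]])
    ultimately have "f (b (f x)) = f x"
      by simp
    then show "(f \<ominus>\<^bsub>End\<^esub> f \<otimes>\<^bsub>End\<^esub> (b \<otimes>\<^bsub>End\<^esub> f)) x = \<zero>\<^bsub>M\<^esub>"
      using x f b by simp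
  qed (use f b in simp)
  then show ?thesis
    using b idem by blast
qed

section \<open>CS-Rickart and C2 from idempotent multiples\<close>

lemma kernel_essential_in_idempotent_kernel:
  assumes f: "f \<in> carrier End" and b: "b \<in> carrier End"
    and D: "f \<ominus>\<^bsub>End\<^esub> f \<otimes>\<^bsub>End\<^esub> (b \<otimes>\<^bsub>End\<^esub> f) \<in> Delta R M"
  shows "essential_submodule R M (a_kernel M M f) (a_kernel M M (b \<otimes>\<^bsub>End\<^esub> f))"
proof -
  let ?d = "f \<ominus>\<^bsub>End\<^esub> f \<otimes>\<^bsub>End\<^esub> (b \<otimes>\<^bsub>End\<^esub> f)"
  have "essential_submodule R M (a_kernel M M ?d \<inter> a_kernel M M (b \<otimes>\<^bsub>End\<^esub> f))
      (a_kernel M M (b \<otimes>\<^bsub>End\<^esub> f))"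
    using D f b by (intro essential_submodule_carrier_restrict submodule_kernel) (auto simp: Delta_iff)
  \<comment> \<open>On \<open>Ker (b f)\<close> the difference \<open>f - f b f\<close> agrees with
    \<open>f\<close>, and \<open>Ker f\<close> is contained in \<open>Ker (b f)\<close>.\<close>
  also have "a_kernel M M ?d \<inter> a_kernel M M (b \<otimes>\<^bsub>End\<^esub> f) = a_kernel M M f"
    using f b by (auto simp: a_kernel_def')
  finally show ?thesis .
qed

text \<open>The required summand is the kernel of the idempotent \<open>b f\<close>.\<close>

lemma idempotent_multiples_imp_CS_Rickart:
  assumes "\<And>f. f \<in> carrier End \<Longrightarrow> \<exists>b\<in>carrier End.
    b \<otimes>\<^bsub>End\<^esub> f \<otimes>\<^bsub>End\<^esub> (b \<otimes>\<^bsub>End\<^esub> f) = b \<otimes>\<^bsub>End\<^esub> f \<and>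
    f \<ominus>\<^bsub>End\<^esub> f \<otimes>\<^bsub>End\<^esub> (b \<otimes>\<^bsub>End\<^esub> f) \<in> Delta R M"
  shows "CS_Rickart R M"
  unfolding CS_Rickart_def
proof
  fix f assume f: "f \<in> carrier End"
  then obtain b where b: "b \<in> carrier End" "b \<otimes>\<^bsub>End\<^esub> f \<otimes>\<^bsub>End\<^esub> (b \<otimes>\<^bsub>End\<^esub> f) = b \<otimes>\<^bsub>End\<^esub> f"
    "f \<ominus>\<^bsub>End\<^esub> f \<otimes>\<^bsub>End\<^esub> (b \<otimes>\<^bsub>End\<^esub> f) \<in> Delta R M"
    using assms by blast
  show "\<exists>D. direct_summand R M D \<and> essential_submodule R M (a_kernel M M f) D"
    using direct_summand_idempotent_kernel[OF End.m_closed[OF b(1) f] b(2)]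
      kernel_essential_in_idempotent_kernel[OF f b(1,3)] by blast
qed

lemma idempotent_multiples_imp_C2:
  assumes mult: "\<And>f. f \<in> carrier End \<Longrightarrow> \<exists>b\<in>carrier End.
    b \<otimes>\<^bsub>End\<^esub> f \<otimes>\<^bsub>End\<^esub> (b \<otimes>\<^bsub>End\<^esub> f) = b \<otimes>\<^bsub>End\<^esub> f \<and>
    f \<ominus>\<^bsub>End\<^esub> f \<otimes>\<^bsub>End\<^esub> (b \<otimes>\<^bsub>End\<^esub> f) \<in> Delta R M"
  shows "C2_module R M"
  unfolding C2_module_def
proof (intro allI impI)
  fix N D assume "submodule N R M \<and> direct_summand R M D \<and>
    rmod_iso R (M\<lparr>carrier := N\<rparr>) (M\<lparr>carrier := D\<rparr>)"
  then obtain k where N: "submodule N R M" and D: "direct_summand R M D"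
    and k: "k \<in> rmod_hom R (M\<lparr>carrier := N\<rparr>) (M\<lparr>carrier := D\<rparr>)" "bij_betw k N D"
    by (auto simp: rmod_iso_def)
  obtain e where e: "e \<in> carrier End" "e \<otimes>\<^bsub>End\<^esub> e = e" "e ` carrier M = D" "\<And>x. x \<in> D \<Longrightarrow> e x = x"
    using direct_summand_projection[OF D] by blast
  \<comment> \<open>The given isomorphism runs from \<open>N\<close> to \<open>D\<close>; its
    inverse after the projection onto \<open>D\<close> yields an endomorphism with image
    \<open>N\<close>.\<close>
  define h where "h = (\<lambda>y\<in>D. inv_into N k y)"
  have h: "h \<in> rmod_hom R (M\<lparr>carrier := D\<rparr>) (M\<lparr>carrier := N\<rparr>)"
    unfolding h_def by (rule rmod_hom_inv[OF k N])
  have h_bij: "bij_betw h D N"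
    unfolding h_def using bij_betw_inv_into[OF k(2)] by (simp cong: bij_betw_cong)
  define f where "f = (\<lambda>x\<in>carrier M. h (e x))"
  have f: "f \<in> carrier End"
    unfolding f_def using e(3)
    by (intro endo_extend_projection[OF h submodule_subset[OF N] e(1)]) auto
  have f_image: "f ` carrier M = N"
  proof -
    have "f ` carrier M = h ` e ` carrier M"
      by (auto simp: f_def image_image)
    then show ?thesis
      using h_bij by (simp add: e(3) bij_betw_def)
  qed
  have D_sub: "submodule D R M"
    using D by (simp add: direct_summand_def)
  \<comment> \<open>\<open>h\<close> is injective, so the kernel is that of the idempotent
    \<open>e\<close>, hence a summand.\<close>
  have ker: "a_kernel M M f = a_kernel M M e"
  proof -
    have "h \<zero>\<^bsub>M\<^esub> = \<zero>\<^bsub>M\<^esub>"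
      using endo_zero[OF f] e(1) by (simp add: f_def)
    then have "h y = \<zero>\<^bsub>M\<^esub> \<longleftrightarrow> y = \<zero>\<^bsub>M\<^esub>" if "y \<in> D" for y
      using that h_bij submodule_zero[OF D_sub] by (metis bij_betw_def inj_onD)
    then show ?thesis
      using e(3) by (auto simp: a_kernel_def' f_def)
  qed
  obtain b where b: "b \<in> carrier End" "b \<otimes>\<^bsub>End\<^esub> f \<otimes>\<^bsub>End\<^esub> (b \<otimes>\<^bsub>End\<^esub> f) = b \<otimes>\<^bsub>End\<^esub> f"
    "f \<ominus>\<^bsub>End\<^esub> f \<otimes>\<^bsub>End\<^esub> (b \<otimes>\<^bsub>End\<^esub> f) \<in> Delta R M"
    using mult[OF f] by blast
  have bf: "b \<otimes>\<^bsub>End\<^esub> f \<in> carrier End"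
    using b(1) f by simp
  \<comment> \<open>\<open>Ker f\<close> is a summand and essential in \<open>Ker (b f)\<close>, so
    the two agree.\<close>
  have ker_bf: "a_kernel M M f = a_kernel M M (b \<otimes>\<^bsub>End\<^esub> f)"
    using direct_summand_idempotent_kernel[OF e(1,2)]
    by (intro direct_summand_essential_eq kernel_essential_in_idempotent_kernel f b) (simp add: ker)
  \<comment> \<open>Since \<open>b f\<close> is idempotent, \<open>x - b (f x)\<close> is in its
    kernel, which is also that of \<open>f\<close>.\<close>
  have fbf: "f (b (f x)) = f x" if x: "x \<in> carrier M" for x
  proof -
    have "x \<ominus>\<^bsub>M\<^esub> b (f x) \<in> a_kernel M M f"
      unfolding ker_bf using idempotent_kernel_image(2)[OF bf b(2) x] x by simp
    then show ?thesis
      using x f b(1) by (simp add: a_kernel_def' endo_minus)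
  qed
  have "f \<otimes>\<^bsub>End\<^esub> b \<otimes>\<^bsub>End\<^esub> (f \<otimes>\<^bsub>End\<^esub> b) = f \<otimes>\<^bsub>End\<^esub> b"
    by (rule endo_eqI) (use f b(1) in \<open>simp_all add: fbf\<close>)
  then have "direct_summand R M ((f \<otimes>\<^bsub>End\<^esub> b) ` carrier M)"
    using f b(1) by (intro direct_summand_idempotent_image) simp_all
  \<comment> \<open>The image of \<open>f b\<close> lies in that of \<open>f\<close>, and
    \<open>f b\<close> fixes every \<open>f x\<close>.\<close>
  also have "(f \<otimes>\<^bsub>End\<^esub> b) ` carrier M = N"
  proof (intro equalityI subsetI)
    show "y \<in> N" if "y \<in> (f \<otimes>\<^bsub>End\<^esub> b) ` carrier M" for y
      using that f_image b(1) by auto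
    show "y \<in> (f \<otimes>\<^bsub>End\<^esub> b) ` carrier M" if y: "y \<in> N" for y
    proof -
      obtain x where x: "x \<in> carrier M" "y = f x"
        using y f_image by blast
      have fx: "f x \<in> carrier M"
        using f x(1) by simp
      have "(f \<otimes>\<^bsub>End\<^esub> b) (f x) = y"
        using fbf[OF x(1)] fx x(2) by simp
      with imageI[OF fx, of "f \<otimes>\<^bsub>End\<^esub> b"] show ?thesis
        by (simp only:)
    qed
  qed
  finally show "direct_summand R M N" .
qed

section \<open>Equivalence of the two conditions\<close>

theorem semiregular_iff_CS_Rickart_C2:
  "semiregular_ring End \<and> jacobson_radical End = Delta R M \<longleftrightarrow> CS_Rickart R M \<and> C2_module R M"
proof
  assume asm: "semiregular_ring End \<and> jacobson_radical End = Delta R M"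
  \<comment> \<open>The equality with \<open>Delta\<close> makes the radical an ideal and replaces
    it by \<open>Delta\<close> in the elementwise condition.\<close>
  then have "\<exists>b\<in>carrier End. b \<otimes>\<^bsub>End\<^esub> f \<otimes>\<^bsub>End\<^esub> (b \<otimes>\<^bsub>End\<^esub> f) = b \<otimes>\<^bsub>End\<^esub> f \<and>
    f \<ominus>\<^bsub>End\<^esub> f \<otimes>\<^bsub>End\<^esub> (b \<otimes>\<^bsub>End\<^esub> f) \<in> Delta R M" if "f \<in> carrier End" for f
    using End.semiregular_ring_iff ideal_Delta that by simp
  then show "CS_Rickart R M \<and> C2_module R M"
    using idempotent_multiples_imp_CS_Rickart idempotent_multiples_imp_C2 by blast
next
  assume asm: "CS_Rickart R M \<and> C2_module R M"
  interpret Delta: ideal "Delta R M" End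
    by (rule ideal_Delta)
  have mult: "\<exists>b\<in>carrier End. b \<otimes>\<^bsub>End\<^esub> f \<otimes>\<^bsub>End\<^esub> (b \<otimes>\<^bsub>End\<^esub> f) = b \<otimes>\<^bsub>End\<^esub> f \<and>
    f \<ominus>\<^bsub>End\<^esub> f \<otimes>\<^bsub>End\<^esub> (b \<otimes>\<^bsub>End\<^esub> f) \<in> Delta R M" if "f \<in> carrier End" for f
    using CS_Rickart_C2_idempotent_multiple asm that by blast
  have "jacobson_radical End = Delta R M"
  proof
    show "Delta R M \<subseteq> jacobson_radical End"
      using C2_module_one_minus_Delta_unit asm
      by (intro End.ideal_subset_jacobson_radical ideal_Delta) blast
    show "jacobson_radical End \<subseteq> Delta R M"
    proof
      fix a assume a: "a \<in> jacobson_radical End"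
      then have ac: "a \<in> carrier End"
        by (simp add: jacobson_radical_def)
      obtain b where b: "b \<in> carrier End" "a \<ominus>\<^bsub>End\<^esub> a \<otimes>\<^bsub>End\<^esub> (b \<otimes>\<^bsub>End\<^esub> a) \<in> Delta R M"
        using mult[OF ac] by blast
      \<comment> \<open>\<open>a b\<close> is in the radical, so \<open>?u\<close> is a unit. As
        \<open>?u a\<close> is in the ideal \<open>Delta\<close>, cancelling \<open>?u\<close>
        leaves \<open>a\<close> in \<open>Delta\<close>.\<close>
      let ?u = "\<one>\<^bsub>End\<^esub> \<ominus>\<^bsub>End\<^esub> a \<otimes>\<^bsub>End\<^esub> b"
      have u: "?u \<in> Units End"
        by (intro End.jacobson_radical_unit End.jacobson_radical_mult_closed a b)
      have "?u \<otimes>\<^bsub>End\<^esub> a = a \<ominus>\<^bsub>End\<^esub> a \<otimes>\<^bsub>End\<^esub> (b \<otimes>\<^bsub>End\<^esub> a)"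
        using ac b(1) by (simp add: a_minus_def End.l_distr End.l_minus End.m_assoc)
      then have "inv\<^bsub>End\<^esub> ?u \<otimes>\<^bsub>End\<^esub> (?u \<otimes>\<^bsub>End\<^esub> a) \<in> Delta R M"
        using b(2) u by (simp add: Delta.I_l_closed)
      also have "inv\<^bsub>End\<^esub> ?u \<otimes>\<^bsub>End\<^esub> (?u \<otimes>\<^bsub>End\<^esub> a) = a"
        using u ac by (simp add: End.m_assoc[symmetric] End.Units_closed)
      finally show "a \<in> Delta R M" .
    qed
  qed
  with mult End.semiregular_ring_iff ideal_Delta
  show "semiregular_ring End \<and> jacobson_radical End = Delta R M"
    by simp
qed

end

theorem theorem3p13:
  fixes R :: "('a, 'r) ring_scheme" and M :: "('a, 'b, 'm) module_scheme"
  assumes "right_module R M"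
    and "self_generator R M"
  shows "semiregular_ring (endo_ring R M) \<and>
           jacobson_radical (endo_ring R M) = Delta R M \<longleftrightarrow>
         CS_Rickart R M \<and> C2_module R M"
proof -
  interpret right_module R M by fact
  show ?thesis
    by (rule semiregular_iff_CS_Rickart_C2)
qed

end
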